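(* Let $\xi(t)=(\xi^1(t),\dots,\xi^d(t))$, $t\in\mathbb{R}$, be an $\mathbb{R}^d$-valued stochastic process such that $\mathbf{E}e^{\xi^k(t)}<\infty$ for all $t\in\mathbb{R}$ and $k=1,\dots,d$. Then $\xi$ is Brown--Resnick stationary if and only if $$\varphi_{t_1,\dots,t_n}(u_1-\imath d^{-1}\mathbf{1},u_2,\dots,u_n)=\varphi_{t_1+s,\dots,t_n+s}(u_1-\imath d^{-1}\mathbf{1},u_2,\dots,u_n)$$ for all $n\ge1$, $s,t_1,\dots,t_n\in\mathbb{R}$ and $u_1,\dots,u_n\in\mathbb{R}^d$ satisfying $\sum_{i=1}^n\sum_{j=1}^d u_i^j=0$, where $\mathbf{1}$ is the vector in $\mathbb{R}^d$ with all components equal to one and $u_i^j$ is the $j$-th component of $u_i$.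
   Context: $\imath$ is the imaginary unit and $\varphi_{t_1,\dots,t_n}(w_1,\dots,w_n)=\mathbf{E}\exp\{\imath\sum_{i=1}^n\langle w_i,\xi(t_i)\rangle\}$, with $\langle\cdot,\cdot\rangle$ extended bilinearly to complex $w_1$. Brown--Resnick stationarity: let $\{y_i,\,i\ge1\}$ be a Poisson point process on $(0,\infty)$ with intensity measure $y^{-2}dy$, independent of i.i.d. copies $\xi_1,\xi_2,\dots$ of $\xi$, and let $$\eta(t)=\bigvee_{i=1}^\infty y_ie^{\xi_i(t)},\qquad t\in\mathbb{R},$$ an $\mathbb{R}^d$-valued process, where exponential and maximum are taken coordinatewise. A process $\xi$ with $\mathbf{E}e^{\xi^k(t)}<\infty$ for all $t,k$ is called Brown--Resnick stationary if $\eta$ is (strictly) stationary. *)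

theory Defs
  imports "HOL-Probability.Probability"
begin

definition count_points :: "(nat \<Rightarrow> 'w \<Rightarrow> 'a) \<Rightarrow> 'a set \<Rightarrow> 'w \<Rightarrow> ennreal" where
  "count_points y B \<omega> = emeasure (count_space UNIV) {i. y i \<omega> \<in> B}"

(* The point process is given by an enumeration y 0, y 1, ... of its points (with multiplicity).
   Such an enumeration by all natural numbers exists exactly when the total intensity is infinite.
   Membership of y i in measurable N \<mu> forces the points to lie in space \<mu>. *)
definition poisson_point_process :: "'w measure \<Rightarrow> 'a measure \<Rightarrow> (nat \<Rightarrow> 'w \<Rightarrow> 'a) \<Rightarrow> bool" where
  "poisson_point_process N \<mu> y \<longleftrightarrow>
     prob_space N \<and>
     (\<forall>i. y i \<in> measurable N \<mu>) \<and>
     (\<forall>B\<in>sets \<mu>. emeasure \<mu> B < \<infinity> \<longrightarrow>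
        (\<forall>k::nat. measure N {\<omega> \<in> space N. count_points y B \<omega> = of_nat k}
                  = exp (- measure \<mu> B) * measure \<mu> B ^ k / fact k)) \<and>
     (\<forall>B\<in>sets \<mu>. emeasure \<mu> B = \<infinity> \<longrightarrow> (AE \<omega> in N. count_points y B \<omega> = \<infinity>)) \<and>
     (\<forall>(n::nat) (B :: nat \<Rightarrow> 'a set). (\<forall>i<n. B i \<in> sets \<mu>) \<and> disjoint_family_on B {..<n} \<longrightarrow>
        prob_space.indep_vars N (\<lambda>_. borel) (\<lambda>i. count_points y (B i)) {..<n})"

definition brown_resnick_intensity :: "real measure" where
  "brown_resnick_intensity =
     density (restrict_space lborel {0<..}) (\<lambda>y. ennreal (1 / y\<^sup>2))"

abbreviation path_algebra :: "(real \<Rightarrow> real ^ 'd) measure" where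
  "path_algebra \<equiv> (\<Pi>\<^sub>M t\<in>UNIV. borel)"

(* The data on N entering the definition of eta: the points y, and i.i.d. copies \<Xi> i of \<xi> (equality
   of laws of processes, on the product sigma-algebra) which are jointly independent of the sequence
   y. Independence of y and \<Xi> is spelled out through the generated sigma-algebras because
   indep_var requires both random elements to have the same type. *)
definition brown_resnick_data ::
    "'a measure \<Rightarrow> (real \<Rightarrow> 'a \<Rightarrow> real ^ 'd) \<Rightarrow>
     'w measure \<Rightarrow> (nat \<Rightarrow> 'w \<Rightarrow> real) \<Rightarrow> (nat \<Rightarrow> real \<Rightarrow> 'w \<Rightarrow> real ^ 'd) \<Rightarrow> bool" where
  "brown_resnick_data M \<xi> N y \<Xi> \<longleftrightarrow>
     poisson_point_process N brown_resnick_intensity y \<and>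
     prob_space.indep_vars N (\<lambda>_. path_algebra) (\<lambda>i \<omega> t. \<Xi> i t \<omega>) UNIV \<and>
     (\<forall>i. distr N path_algebra (\<lambda>\<omega> t. \<Xi> i t \<omega>) = distr M path_algebra (\<lambda>\<omega> t. \<xi> t \<omega>)) \<and>
     prob_space.indep_set N
       (sets (vimage_algebra (space N) (\<lambda>\<omega> i. y i \<omega>) (\<Pi>\<^sub>M i\<in>UNIV. borel)))
       (sets (vimage_algebra (space N) (\<lambda>\<omega> i t. \<Xi> i t \<omega>) (\<Pi>\<^sub>M i\<in>UNIV. path_algebra)))"

(* If every exp (\<xi> t $ k) is integrable, the supremum is almost surely finite, for each t and k;
   on the exceptional null set the real-valued SUP is a default constant. *)
definition brown_resnick_process ::
    "(nat \<Rightarrow> 'w \<Rightarrow> real) \<Rightarrow> (nat \<Rightarrow> real \<Rightarrow> 'w \<Rightarrow> real ^ 'd) \<Rightarrow> real \<Rightarrow> 'w \<Rightarrow> real ^ 'd" where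
  "brown_resnick_process y \<Xi> t \<omega> = (\<chi> k. SUP i. y i \<omega> * exp (\<Xi> i t \<omega> $ k))"

definition strictly_stationary :: "'w measure \<Rightarrow> (real \<Rightarrow> 'w \<Rightarrow> real ^ 'd) \<Rightarrow> bool" where
  "strictly_stationary N X \<longleftrightarrow>
     (\<forall>t. X t \<in> borel_measurable N) \<and>
     (\<forall>(n::nat) (t :: nat \<Rightarrow> real) (s::real).
        distr N (\<Pi>\<^sub>M i\<in>{..<n}. borel) (\<lambda>\<omega>. \<lambda>i\<in>{..<n}. X (t i + s) \<omega>)
        = distr N (\<Pi>\<^sub>M i\<in>{..<n}. borel) (\<lambda>\<omega>. \<lambda>i\<in>{..<n}. X (t i) \<omega>))"

(* Bilinear, not sesquilinear, in the complex argument. *)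
definition bilinear_pairing :: "complex ^ 'd \<Rightarrow> real ^ 'd \<Rightarrow> complex" where
  "bilinear_pairing w x = (\<Sum>j\<in>UNIV. w $ j * complex_of_real (x $ j))"

definition joint_char ::
    "'a measure \<Rightarrow> (real \<Rightarrow> 'a \<Rightarrow> real ^ 'd) \<Rightarrow> nat \<Rightarrow> (nat \<Rightarrow> real) \<Rightarrow> (nat \<Rightarrow> complex ^ 'd) \<Rightarrow> complex" where
  "joint_char M \<xi> n t w =
     (LINT \<omega>|M. exp (\<i> * (\<Sum>i<n. bilinear_pairing (w i) (\<xi> (t i) \<omega>))))"

(* Indices run from 0 to n - 1, so the distinguished first argument has index 0. *)
definition shifted_args :: "(nat \<Rightarrow> real ^ 'd) \<Rightarrow> nat \<Rightarrow> complex ^ 'd" where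
  "shifted_args u i =
     (\<chi> j. complex_of_real (u i $ j) - (if i = 0 then \<i> / of_nat CARD('d) else 0))"

end

theory Submission
  imports Defs
begin

text \<open>
  Fix finitely many times and write \<open>X a\<close>, for \<open>a\<close> in a finite set \<open>I\<close> of pairs (time, coordinate),
  for the corresponding coordinates of \<open>\<xi>\<close>. The proof identifies both sides of the equivalence with
  one statement: the shift invariance of all expectations
  \<open>E (Max\<^sub>a c\<^sub>a exp X\<^sub>a)\<close> with positive weights \<open>c\<close>.

  Stationarity and max moments. The event that every coordinate \<open>\<eta>\<^sub>a\<close> stays below \<open>x\<^sub>a > 0\<close> says that no
  point \<open>(y\<^sub>i, \<xi>\<^sub>i)\<close> of the marked process satisfies \<open>y\<^sub>i Z(\<xi>\<^sub>i) > 1\<close>, where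
  \<open>Z = Max\<^sub>a exp X\<^sub>a / x\<^sub>a\<close>. Conditioning on the points turns its probability into the expectation of
  \<open>\<Prod>\<^sub>i P(y\<^sub>i Z \<le> 1)\<close> (\<open>prob_marks_of_points\<close>), which the generating functional of a Poisson process
  (\<open>poisson_generating_functional\<close>) evaluates as \<open>exp (- \<integral> P(y Z > 1) y\<^sup>-\<^sup>2 dy) = exp (- E Z)\<close>.
  Hence the finite-dimensional distribution functions of \<open>\<eta>\<close> and the max moments determine each other
  (\<open>strictly_stationary_iff_max_moments\<close>).

  Max moments and characteristic functions. The argument \<open>u\<^sub>1 - \<i> d\<^sup>-\<^sup>1 1\<close> changes the measure by the
  density \<open>exp A\<close>, where \<open>A\<close> is the mean of the coordinates at the first time, and the restriction
  \<open>\<Sum> u = 0\<close> means that only differences \<open>X\<^sub>a - A\<close> are observed. So the characteristic functions in the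
  theorem are those of the vector \<open>(X\<^sub>a - A)\<close> under the tilted measure. They determine its law by
  Levy's uniqueness theorem in several variables, and therefore they determine
  \<open>E (Max\<^sub>a c\<^sub>a exp X\<^sub>a) = E (exp A * Max\<^sub>a c\<^sub>a exp (X\<^sub>a - A))\<close>
  (\<open>expectation_Max_eq_of_tilted_char_eq\<close>). Conversely, the right derivative of the max moment in one
  weight \<open>c\<^sub>b\<close> is the expectation of \<open>exp X\<^sub>b\<close> over the event that the maximum is attained at \<open>b\<close>; this
  is the joint distribution function of the differences \<open>X\<^sub>a - X\<^sub>b\<close> under the tilt by \<open>exp X\<^sub>b\<close>, and
  passing from the tilt by \<open>exp X\<^sub>b\<close> to the tilt by \<open>exp A\<close> costs only the factor \<open>exp (A - X\<^sub>b)\<close>, again a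
  function of differences (\<open>tilted_char_eq_of_expectation_Max_eq\<close>).
\<close>

section \<open>Joint laws are determined by characteristic and by distribution functions\<close>

text \<open>
  Levy's theorem speaks of probability measures. The value of the characteristic function at \<open>0\<close> is the
  total mass, so both measures can be normalised by the same constant.
\<close>

lemma finite_borel_measure_eq_of_char_eq:
  assumes "finite_borel_measure \<mu>" "finite_borel_measure \<nu>" "char \<mu> = char \<nu>"
  shows "\<mu> = \<nu>"
proof -
  interpret \<mu>: finite_borel_measure \<mu> by fact
  interpret \<nu>: finite_borel_measure \<nu> by fact
  have sets: "sets \<mu> = sets borel" "sets \<nu> = sets borel"
    by (simp_all add: \<mu>.M_is_borel \<nu>.M_is_borel)
  have "complex_of_real (measure \<mu> (space \<mu>)) = char \<mu> 0"
    by (simp add: char_def scaleR_conv_of_real)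
  also have "\<dots> = complex_of_real (measure \<nu> (space \<nu>))"
    unfolding assms(3) by (simp add: char_def scaleR_conv_of_real)
  finally have mass: "measure \<mu> (space \<mu>) = measure \<nu> (space \<nu>)"
    by simp
  define c where "c = measure \<mu> (space \<mu>)"
  show ?thesis
  proof (cases "c = 0")
    case True
    have "measure \<mu> A = 0" "measure \<nu> A = 0" for A
      using True \<mu>.bounded_measure[of A] \<nu>.bounded_measure[of A] mass
      by (simp_all add: c_def measure_le_0_iff)
    then show ?thesis
      by (intro measure_eqI) (auto simp: sets \<mu>.emeasure_eq_measure \<nu>.emeasure_eq_measure)
  next
    case False
    then have c: "c > 0" by (simp add: c_def zero_less_measure_iff)
    have *: "real_distribution (density \<rho> (\<lambda>_. ennreal (1 / c)))"
        "char (density \<rho> (\<lambda>_. ennreal (1 / c))) = (\<lambda>t. char \<rho> t / c)"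
      if "finite_borel_measure \<rho>" "measure \<rho> (space \<rho>) = c" for \<rho>
    proof -
      interpret \<rho>: finite_borel_measure \<rho> by fact
      have "emeasure (density \<rho> (\<lambda>_. ennreal (1 / c))) (space \<rho>) = 1"
        using c that(2)
        by (simp add: emeasure_density_const \<rho>.emeasure_eq_measure ennreal_mult'[symmetric])
      then show "real_distribution (density \<rho> (\<lambda>_. ennreal (1 / c)))"
        by (auto intro!: prob_spaceI simp: real_distribution_def real_distribution_axioms_def
            \<rho>.M_is_borel)
      show "char (density \<rho> (\<lambda>_. ennreal (1 / c))) = (\<lambda>t. char \<rho> t / c)"
      proof
        fix t
        have [measurable]: "(\<lambda>x. iexp (t * x)) \<in> borel_measurable \<rho>"
          by (simp add: measurable_cong_sets[OF \<rho>.M_is_borel refl])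
        show "char (density \<rho> (\<lambda>_. ennreal (1 / c))) t = char \<rho> t / c"
          unfolding char_def using c
          by (subst integral_density) (simp_all del: of_real_mult add: scaleR_conv_of_real)
      qed
    qed
    have "density \<mu> (\<lambda>_. ennreal (1 / c)) = density \<nu> (\<lambda>_. ennreal (1 / c))"
    proof (intro Levy_uniqueness *(1) assms(1,2))
      show m: "measure \<mu> (space \<mu>) = c" "measure \<nu> (space \<nu>) = c"
        using mass by (simp_all add: c_def)
      show "char (density \<mu> (\<lambda>_. ennreal (1 / c))) = char (density \<nu> (\<lambda>_. ennreal (1 / c)))"
        by (simp only: *(2)[OF assms(1) m(1)] *(2)[OF assms(2) m(2)] assms(3))
    qed
    then have eq: "ennreal (1 / c) * emeasure \<mu> A = ennreal (1 / c) * emeasure \<nu> A" if "A \<in> sets borel" for A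
      using that emeasure_density_const[of A] by (metis sets)
    show ?thesis
    proof (rule measure_eqI)
      fix A assume "A \<in> sets \<mu>"
      with eq[of A] show "emeasure \<mu> A = emeasure \<nu> A"
        using c by (simp add: sets ennreal_mult_cancel_left)
    qed (simp add: sets)
  qed
qed

lemma integral_indicator_eq_of_weighted_char_eq_nonneg:
  fixes f h :: "'a \<Rightarrow> real" and g k :: "'b \<Rightarrow> real"
  assumes "finite_measure P" "finite_measure Q"
    and [measurable]: "f \<in> borel_measurable P" "g \<in> borel_measurable Q"
      "h \<in> borel_measurable P" "k \<in> borel_measurable Q" "B \<in> sets borel"
    and h: "\<And>x. 0 \<le> h x" "\<And>x. h x \<le> C" and k: "\<And>x. 0 \<le> k x" "\<And>x. k x \<le> C"
    and eq: "\<And>v. (LINT x|P. h x *\<^sub>R iexp (v * f x)) = (LINT x|Q. k x *\<^sub>R iexp (v * g x))"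
  shows "(LINT x|P. indicator B (f x) * h x) = (LINT x|Q. indicator B (g x) * k x)"
proof -
  have *: "finite_borel_measure (distr (density R (\<lambda>x. ennreal (w x))) borel F)"
      "char (distr (density R (\<lambda>x. ennreal (w x))) borel F) v = (LINT x|R. w x *\<^sub>R iexp (v * F x))"
      "measure (distr (density R (\<lambda>x. ennreal (w x))) borel F) B = (LINT x|R. indicator B (F x) * w x)"
    if "finite_measure R" and [measurable]: "F \<in> borel_measurable R" "w \<in> borel_measurable R"
      and w: "\<And>x. 0 \<le> w x" "\<And>x. w x \<le> C"
    for R :: "'c measure" and F w v
  proof -
    interpret R: finite_measure R by fact
    have int: "integrable R w"
      by (rule R.integrable_const_bound[where B=C]) (use w in auto)
    have "finite_measure (density R (\<lambda>x. ennreal (w x)))"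
      using int w by (intro finite_measureI)
        (simp add: emeasure_density nn_integral_eq_integral cong: nn_integral_cong)
    then have "finite_measure (distr (density R (\<lambda>x. ennreal (w x))) borel F)"
      by (rule finite_measure.finite_measure_distr) simp
    then show "finite_borel_measure (distr (density R (\<lambda>x. ennreal (w x))) borel F)"
      by (simp add: finite_borel_measure_def finite_borel_measure_axioms_def)
    show "char (distr (density R (\<lambda>x. ennreal (w x))) borel F) v = (LINT x|R. w x *\<^sub>R iexp (v * F x))"
      using w by (simp add: char_def integral_distr integral_density)
    have "measure (distr (density R (\<lambda>x. ennreal (w x))) borel F) B
        = (LINT x|distr (density R (\<lambda>x. ennreal (w x))) borel F. indicator B x)"
      by simp
    also have "\<dots> = (LINT x|R. indicator B (F x) * w x)"
      using w by (subst integral_distr) (simp_all add: integral_density mult.commute del: integral_indicator Bochner_Integration.integral_indicator)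
    finally show "measure (distr (density R (\<lambda>x. ennreal (w x))) borel F) B = (LINT x|R. indicator B (F x) * w x)" .
  qed
  have "distr (density P (\<lambda>x. ennreal (h x))) borel f = distr (density Q (\<lambda>x. ennreal (k x))) borel g"
    by (rule finite_borel_measure_eq_of_char_eq)
      (use assms(1,2) h k eq in \<open>auto simp: * intro!: ext\<close>)
  then show ?thesis
    using *(3)[of P f h] *(3)[of Q g k] assms(1,2) h k by simp
qed

text \<open>
  A weight \<open>h\<close> with values in \<open>[-1, 1]\<close> defines only a signed measure, but \<open>1 + h\<close> and \<open>1\<close> are
  nonnegative, and the claim for \<open>h\<close> is the difference of the claims for these two weights.
\<close>

lemma integral_indicator_eq_of_weighted_char_eq:
  fixes f h :: "'a \<Rightarrow> real" and g k :: "'b \<Rightarrow> real"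
  assumes "finite_measure P" "finite_measure Q"
    and [measurable]: "f \<in> borel_measurable P" "g \<in> borel_measurable Q"
      "h \<in> borel_measurable P" "k \<in> borel_measurable Q" "B \<in> sets borel"
    and h: "\<And>x. \<bar>h x\<bar> \<le> 1" and k: "\<And>x. \<bar>k x\<bar> \<le> 1"
    and eq1: "\<And>v. (LINT x|P. iexp (v * f x)) = (LINT x|Q. iexp (v * g x))"
    and eqw: "\<And>v. (LINT x|P. h x *\<^sub>R iexp (v * f x)) = (LINT x|Q. k x *\<^sub>R iexp (v * g x))"
  shows "(LINT x|P. indicator B (f x) * h x) = (LINT x|Q. indicator B (g x) * k x)"
proof -
  interpret P: finite_measure P by fact
  interpret Q: finite_measure Q by fact
  have intP: "integrable P (\<lambda>x. iexp (v * f x))" "integrable P (\<lambda>x. h x *\<^sub>R iexp (v * f x))"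
      "integrable P (\<lambda>x. indicator B (f x) * h x)" "integrable P (\<lambda>x. indicat_real B (f x))" for v
    by (rule P.integrable_const_bound[where B=1]; use h in \<open>auto simp: abs_mult mult_le_one indicator_def\<close>)+
  have intQ: "integrable Q (\<lambda>x. iexp (v * g x))" "integrable Q (\<lambda>x. k x *\<^sub>R iexp (v * g x))"
      "integrable Q (\<lambda>x. indicator B (g x) * k x)" "integrable Q (\<lambda>x. indicat_real B (g x))" for v
    by (rule Q.integrable_const_bound[where B=1]; use k in \<open>auto simp: abs_mult mult_le_one indicator_def\<close>)+
  have h': "0 \<le> 1 + h x" "1 + h x \<le> 2" for x using h[of x] by (simp_all add: abs_le_iff)
  have k': "0 \<le> 1 + k x" "1 + k x \<le> 2" for x using k[of x] by (simp_all add: abs_le_iff)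
  have "(LINT x|P. indicator B (f x) * (1 + h x)) = (LINT x|Q. indicator B (g x) * (1 + k x))"
    by (rule integral_indicator_eq_of_weighted_char_eq_nonneg[where C=2])
      (use assms(1,2) h' k' intP intQ eq1 eqw in \<open>auto simp: scaleR_add_left\<close>)
  moreover have "(LINT x|P. indicator B (f x) * (1::real)) = (LINT x|Q. indicator B (g x) * 1)"
    by (rule integral_indicator_eq_of_weighted_char_eq_nonneg[where C=1 and h="\<lambda>_. 1" and k="\<lambda>_. 1"])
      (use assms(1,2) eq1 in auto)
  ultimately show ?thesis
    using intP intQ by (simp add: distrib_left)
qed

lemma integral_scaleR_iexp:
  fixes h S :: "'a \<Rightarrow> real"
  assumes "integrable M (\<lambda>x. h x *\<^sub>R iexp (S x))"
  shows "(LINT x|M. h x *\<^sub>R iexp (S x)) = Complex (LINT x|M. h x * cos (S x)) (LINT x|M. h x * sin (S x))"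
  using integral_Re[OF assms] integral_Im[OF assms] by (simp add: complex_eq_iff Re_exp Im_exp)

text \<open>
  The several-variable uniqueness theorem, by induction on the number of variables. If \<open>S\<close> is a linear
  combination of the remaining variables, then the one-dimensional Fourier transforms of \<open>f b\<close> with the
  weights \<open>cos S\<close> and \<open>sin S\<close> are combinations of values of the joint characteristic function. They
  therefore fix the integrals of \<open>exp (\<i> S)\<close> over every event \<open>f b \<in> B b\<close>, which is the induction hypothesis
  for the measures restricted to that event. The two measures may live on different spaces, and
  they are arbitrary in the induction precisely because of this restriction.
\<close>

lemma joint_measure_eq_of_char_eq:
  fixes f :: "'i \<Rightarrow> 'a \<Rightarrow> real" and g :: "'i \<Rightarrow> 'b \<Rightarrow> real"
  assumes "finite J"
    and "finite_measure P" "finite_measure Q"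
    and "\<And>a. a \<in> J \<Longrightarrow> f a \<in> borel_measurable P" "\<And>a. a \<in> J \<Longrightarrow> g a \<in> borel_measurable Q"
    and "\<And>u. (LINT x|P. iexp (\<Sum>a\<in>J. u a * f a x)) = (LINT x|Q. iexp (\<Sum>a\<in>J. u a * g a x))"
    and "\<And>a. a \<in> J \<Longrightarrow> B a \<in> sets borel"
  shows "measure P {x \<in> space P. \<forall>a\<in>J. f a x \<in> B a} = measure Q {x \<in> space Q. \<forall>a\<in>J. g a x \<in> B a}"
  using assms
proof (induction J arbitrary: P Q)
  case empty
  from empty(5) have "complex_of_real (measure P (space P)) = complex_of_real (measure Q (space Q))"
    by simp
  then show ?case by simp
next
  case (insert b J)
  interpret P: finite_measure P by fact
  interpret Q: finite_measure Q by fact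
  have [measurable]: "f b \<in> borel_measurable P" "g b \<in> borel_measurable Q" "B b \<in> sets borel"
      "\<And>a. a \<in> J \<Longrightarrow> f a \<in> borel_measurable P" "\<And>a. a \<in> J \<Longrightarrow> g a \<in> borel_measurable Q"
      "\<And>a. a \<in> J \<Longrightarrow> B a \<in> sets borel"
    using insert.prems by auto
  define P' where "P' = {x \<in> space P. f b x \<in> B b}"
  define Q' where "Q' = {x \<in> space Q. g b x \<in> B b}"
  have [measurable]: "P' \<in> sets P" "Q' \<in> sets Q" by (simp_all add: P'_def Q'_def)
  have charJ: "(LINT x|P. iexp (v * f b x + c * (\<Sum>a\<in>J. u a * f a x)))
      = (LINT x|Q. iexp (v * g b x + c * (\<Sum>a\<in>J. u a * g a x)))" for v c :: real and u
  proof -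
    have "(\<Sum>a\<in>insert b J. (if a = b then v else c * u a) * F a) = v * F b + c * (\<Sum>a\<in>J. u a * F a)"
      for F :: "'i \<Rightarrow> real"
    proof -
      have "(\<Sum>a\<in>J. (if a = b then v else c * u a) * F a) = (\<Sum>a\<in>J. c * (u a * F a))"
        by (rule sum.cong) (use insert.hyps in auto)
      then show ?thesis
        using insert.hyps by (simp add: sum_distrib_left)
    qed
    from insert.prems(5)[of "\<lambda>a. if a = b then v else c * u a", unfolded this] show ?thesis .
  qed
  have char1: "(LINT x|P. iexp (v * f b x)) = (LINT x|Q. iexp (v * g b x))" for v
    using charJ[of v 0] by simp
  have key: "(LINT x|P. indicator P' x *\<^sub>R iexp (\<Sum>a\<in>J. u a * f a x))
      = (LINT x|Q. indicator Q' x *\<^sub>R iexp (\<Sum>a\<in>J. u a * g a x))" for u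
  proof -
    define S where "S x = (\<Sum>a\<in>J. u a * f a x)" for x
    define T where "T x = (\<Sum>a\<in>J. u a * g a x)" for x
    have [measurable]: "S \<in> borel_measurable P" "T \<in> borel_measurable Q"
      unfolding S_def T_def by measurable
    have intP: "integrable P (\<lambda>x. iexp (v * f b x + c * S x))" for v c
      by (rule P.integrable_const_bound[where B=1]) auto
    have intQ: "integrable Q (\<lambda>x. iexp (v * g b x + c * T x))" for v c
      by (rule Q.integrable_const_bound[where B=1]) auto
    have cosE: "cos s *\<^sub>R iexp r = (iexp (r + 1 * s) + iexp (r + (-1) * s)) / 2" for r s :: real
      by (simp add: complex_eq_iff Re_exp Im_exp cos_add sin_add cos_diff sin_diff)
    have sinE: "sin s *\<^sub>R iexp r = (iexp (r + 1 * s) - iexp (r + (-1) * s)) / (2 * \<i>)" for r s :: real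
      by (simp add: complex_eq_iff Re_exp Im_exp Re_divide Im_divide cos_add sin_add cos_diff sin_diff power2_eq_square)
    note charST = charJ[of _ _ u, folded S_def T_def]
    have "(LINT x|P. indicator (B b) (f b x) * cos (S x)) = (LINT x|Q. indicator (B b) (g b x) * cos (T x))"
    proof (rule integral_indicator_eq_of_weighted_char_eq)
      show "(LINT x|P. cos (S x) *\<^sub>R iexp (v * f b x)) = (LINT x|Q. cos (T x) *\<^sub>R iexp (v * g b x))" for v
        unfolding cosE
        by (simp only: integral_divide_zero Bochner_Integration.integral_add[OF intP intP]
            Bochner_Integration.integral_add[OF intQ intQ] charST)
    qed (auto intro: P.finite_measure_axioms Q.finite_measure_axioms simp: char1 simp del: of_real_mult)
    moreover have "(LINT x|P. indicator (B b) (f b x) * sin (S x)) = (LINT x|Q. indicator (B b) (g b x) * sin (T x))"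
    proof (rule integral_indicator_eq_of_weighted_char_eq)
      show "(LINT x|P. sin (S x) *\<^sub>R iexp (v * f b x)) = (LINT x|Q. sin (T x) *\<^sub>R iexp (v * g b x))" for v
        unfolding sinE
        by (simp only: integral_divide_zero Bochner_Integration.integral_diff[OF intP intP]
            Bochner_Integration.integral_diff[OF intQ intQ] charST)
    qed (auto intro: P.finite_measure_axioms Q.finite_measure_axioms simp: char1 simp del: of_real_mult)
    moreover have "integrable P (\<lambda>x. indicator (B b) (f b x) *\<^sub>R iexp (S x))"
      by (rule P.integrable_const_bound[where B=1]) (auto simp: indicator_def)
    moreover have "integrable Q (\<lambda>x. indicator (B b) (g b x) *\<^sub>R iexp (T x))"
      by (rule Q.integrable_const_bound[where B=1]) (auto simp: indicator_def)
    ultimately have "(LINT x|P. indicator (B b) (f b x) *\<^sub>R iexp (S x)) = (LINT x|Q. indicator (B b) (g b x) *\<^sub>R iexp (T x))"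
      by (simp only: integral_scaleR_iexp)
    moreover have "(LINT x|P. indicator P' x *\<^sub>R iexp (S x)) = (LINT x|P. indicator (B b) (f b x) *\<^sub>R iexp (S x))"
      by (rule Bochner_Integration.integral_cong) (auto simp: P'_def indicator_def)
    moreover have "(LINT x|Q. indicator Q' x *\<^sub>R iexp (T x)) = (LINT x|Q. indicator (B b) (g b x) *\<^sub>R iexp (T x))"
      by (rule Bochner_Integration.integral_cong) (auto simp: Q'_def indicator_def)
    ultimately show ?thesis by (simp add: S_def T_def)
  qed
  have "measure (restrict_space P P') {x \<in> space (restrict_space P P'). \<forall>a\<in>J. f a x \<in> B a}
      = measure (restrict_space Q Q') {x \<in> space (restrict_space Q Q'). \<forall>a\<in>J. g a x \<in> B a}"
    by (rule insert.IH)
      (auto simp: integral_restrict_space key simp del: of_real_sum of_real_mult intro!: finite_measure_restrict_space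
        P.finite_measure_axioms Q.finite_measure_axioms measurable_restrict_space1)
  moreover have "{x \<in> space (restrict_space P P'). \<forall>a\<in>J. f a x \<in> B a} = {x \<in> space P. \<forall>a\<in>insert b J. f a x \<in> B a}"
    by (auto simp: space_restrict_space P'_def)
  moreover have "{x \<in> space (restrict_space Q Q'). \<forall>a\<in>J. g a x \<in> B a} = {x \<in> space Q. \<forall>a\<in>insert b J. g a x \<in> B a}"
    by (auto simp: space_restrict_space Q'_def)
  moreover have "{x \<in> space P. \<forall>a\<in>insert b J. f a x \<in> B a} \<subseteq> P'" "{x \<in> space Q. \<forall>a\<in>insert b J. g a x \<in> B a} \<subseteq> Q'"
    by (auto simp: P'_def Q'_def)
  ultimately show ?case
    by (simp add: measure_restrict_space)
qed

text \<open>
  The same induction by restriction, with the one-dimensional uniqueness theorem for distribution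
  functions applied to the measure restricted to \<open>f a \<le> v a\<close> for the remaining variables.
\<close>

lemma joint_measure_eq_of_cdf_eq:
  fixes f :: "'i \<Rightarrow> 'a \<Rightarrow> real" and g :: "'i \<Rightarrow> 'b \<Rightarrow> real"
  assumes "finite J"
    and "finite_measure P" "finite_measure Q"
    and "\<And>a. a \<in> J \<Longrightarrow> f a \<in> borel_measurable P" "\<And>a. a \<in> J \<Longrightarrow> g a \<in> borel_measurable Q"
    and "\<And>v. measure P {x \<in> space P. \<forall>a\<in>J. f a x \<le> v a} = measure Q {x \<in> space Q. \<forall>a\<in>J. g a x \<le> v a}"
    and "\<And>a. a \<in> J \<Longrightarrow> B a \<in> sets borel"
  shows "measure P {x \<in> space P. \<forall>a\<in>J. f a x \<in> B a} = measure Q {x \<in> space Q. \<forall>a\<in>J. g a x \<in> B a}"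
  using assms
proof (induction J arbitrary: P Q)
  case empty
  then show ?case by simp
next
  case (insert b J)
  interpret P: finite_measure P by fact
  interpret Q: finite_measure Q by fact
  have meas [measurable]: "f b \<in> borel_measurable P" "g b \<in> borel_measurable Q" "B b \<in> sets borel"
      "\<And>a. a \<in> J \<Longrightarrow> f a \<in> borel_measurable P" "\<And>a. a \<in> J \<Longrightarrow> g a \<in> borel_measurable Q"
      "\<And>a. a \<in> J \<Longrightarrow> B a \<in> sets borel" "finite J"
    using insert.prems insert.hyps by auto
  define P' where "P' = {x \<in> space P. f b x \<in> B b}"
  define Q' where "Q' = {x \<in> space Q. g b x \<in> B b}"
  have [measurable]: "P' \<in> sets P" "Q' \<in> sets Q" by (simp_all add: P'_def Q'_def)
  have key: "measure P {x \<in> space P. f b x \<in> B b \<and> (\<forall>a\<in>J. f a x \<le> v a)}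
      = measure Q {x \<in> space Q. g b x \<in> B b \<and> (\<forall>a\<in>J. g a x \<le> v a)}" for v
  proof -
    define U where "U = {x \<in> space P. \<forall>a\<in>J. f a x \<le> v a}"
    define V where "V = {x \<in> space Q. \<forall>a\<in>J. g a x \<le> v a}"
    have [measurable]: "U \<in> sets P" "V \<in> sets Q" by (simp_all add: U_def V_def)
    have fm: "finite_measure (restrict_space P U)" "finite_measure (restrict_space Q V)"
      by (auto intro!: finite_measure_restrict_space P.finite_measure_axioms Q.finite_measure_axioms)
    have fb: "f b \<in> measurable (restrict_space P U) borel" "g b \<in> measurable (restrict_space Q V) borel"
      by (auto intro!: measurable_restrict_space1)
    have md: "measure (distr (restrict_space P U) borel (f b)) C = measure P {x \<in> space P. f b x \<in> C \<and> (\<forall>a\<in>J. f a x \<le> v a)}"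
        "measure (distr (restrict_space Q V) borel (g b)) C = measure Q {x \<in> space Q. g b x \<in> C \<and> (\<forall>a\<in>J. g a x \<le> v a)}"
      if "C \<in> sets borel" for C
      using that fb
      by (auto simp: measure_distr measure_restrict_space space_restrict_space U_def V_def intro!: arg_cong2[where f=measure])
    have "distr (restrict_space P U) borel (f b) = distr (restrict_space Q V) borel (g b)"
    proof (rule cdf_unique')
      show "finite_borel_measure (distr (restrict_space P U) borel (f b))"
        using finite_measure.finite_measure_distr[OF fm(1) fb(1)]
        by (simp add: finite_borel_measure_def finite_borel_measure_axioms_def)
      show "finite_borel_measure (distr (restrict_space Q V) borel (g b))"
        using finite_measure.finite_measure_distr[OF fm(2) fb(2)]
        by (simp add: finite_borel_measure_def finite_borel_measure_axioms_def)
      show "cdf (distr (restrict_space P U) borel (f b)) = cdf (distr (restrict_space Q V) borel (g b))"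
      proof
        fix r
        have e1: "{x \<in> space P. f b x \<in> {..r} \<and> (\<forall>a\<in>J. f a x \<le> v a)} = {x \<in> space P. \<forall>a\<in>insert b J. f a x \<le> (v(b := r)) a}"
          "{x \<in> space Q. g b x \<in> {..r} \<and> (\<forall>a\<in>J. g a x \<le> v a)} = {x \<in> space Q. \<forall>a\<in>insert b J. g a x \<le> (v(b := r)) a}"
          using \<open>b \<notin> J\<close> by auto
        show "cdf (distr (restrict_space P U) borel (f b)) r = cdf (distr (restrict_space Q V) borel (g b)) r"
          by (simp only: cdf_def md e1 sets.sets_into_space borel_closed closed_atMost insert.prems(5))
      qed
    qed
    then show ?thesis
      using md[of "B b"] by simp
  qed
  have "measure (restrict_space P P') {x \<in> space (restrict_space P P'). \<forall>a\<in>J. f a x \<in> B a}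
      = measure (restrict_space Q Q') {x \<in> space (restrict_space Q Q'). \<forall>a\<in>J. g a x \<in> B a}"
  proof (rule insert.IH)
    fix v
    have "{x \<in> space (restrict_space P P'). \<forall>a\<in>J. f a x \<le> v a} = {x \<in> space P. f b x \<in> B b \<and> (\<forall>a\<in>J. f a x \<le> v a)}"
      "{x \<in> space (restrict_space Q Q'). \<forall>a\<in>J. g a x \<le> v a} = {x \<in> space Q. g b x \<in> B b \<and> (\<forall>a\<in>J. g a x \<le> v a)}"
      by (auto simp: space_restrict_space P'_def Q'_def)
    then show "measure (restrict_space P P') {x \<in> space (restrict_space P P'). \<forall>a\<in>J. f a x \<le> v a}
      = measure (restrict_space Q Q') {x \<in> space (restrict_space Q Q'). \<forall>a\<in>J. g a x \<le> v a}"
      using key[of v] by (subst (1 2) measure_restrict_space) (auto simp: P'_def Q'_def)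
  qed (auto intro!: finite_measure_restrict_space
        P.finite_measure_axioms Q.finite_measure_axioms measurable_restrict_space1)
  moreover have "{x \<in> space (restrict_space P P'). \<forall>a\<in>J. f a x \<in> B a} = {x \<in> space P. \<forall>a\<in>insert b J. f a x \<in> B a}"
    by (auto simp: space_restrict_space P'_def)
  moreover have "{x \<in> space (restrict_space Q Q'). \<forall>a\<in>J. g a x \<in> B a} = {x \<in> space Q. \<forall>a\<in>insert b J. g a x \<in> B a}"
    by (auto simp: space_restrict_space Q'_def)
  moreover have "{x \<in> space P. \<forall>a\<in>insert b J. f a x \<in> B a} \<subseteq> P'" "{x \<in> space Q. \<forall>a\<in>insert b J. g a x \<in> B a} \<subseteq> Q'"
    by (auto simp: P'_def Q'_def)
  ultimately show ?case
    by (simp add: measure_restrict_space)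
qed

lemma distr_PiM_eqI_of_rectangles:
  fixes f :: "'i \<Rightarrow> 'a \<Rightarrow> real" and g :: "'i \<Rightarrow> 'b \<Rightarrow> real"
  assumes "finite J" "finite_measure P" "finite_measure Q"
    and [measurable]: "\<And>a. a \<in> J \<Longrightarrow> f a \<in> borel_measurable P" "\<And>a. a \<in> J \<Longrightarrow> g a \<in> borel_measurable Q"
    and eq: "\<And>B. (\<And>a. a \<in> J \<Longrightarrow> B a \<in> sets borel) \<Longrightarrow>
      measure P {x \<in> space P. \<forall>a\<in>J. f a x \<in> B a} = measure Q {x \<in> space Q. \<forall>a\<in>J. g a x \<in> B a}"
  shows "distr P (\<Pi>\<^sub>M a\<in>J. borel) (\<lambda>x. \<lambda>a\<in>J. f a x) = distr Q (\<Pi>\<^sub>M a\<in>J. borel) (\<lambda>x. \<lambda>a\<in>J. g a x)"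
proof (rule measure_eqI_PiM_finite[OF \<open>finite J\<close>])
  interpret P: finite_measure P by fact
  interpret Q: finite_measure Q by fact
  fix B assume "\<And>a. a \<in> J \<Longrightarrow> B a \<in> sets (borel :: real measure)"
  note [measurable] = this
  have [measurable]: "Pi\<^sub>E J B \<in> sets (\<Pi>\<^sub>M a\<in>J. borel)"
    using \<open>finite J\<close> by (intro sets_PiM_I_finite) auto
  have "emeasure (distr P (\<Pi>\<^sub>M a\<in>J. borel) (\<lambda>x. \<lambda>a\<in>J. f a x)) (Pi\<^sub>E J B) = measure P {x \<in> space P. \<forall>a\<in>J. f a x \<in> B a}"
    by (auto simp: emeasure_distr P.emeasure_eq_measure PiE_iff intro!: arg_cong2[where f=measure])
  also have "\<dots> = measure Q {x \<in> space Q. \<forall>a\<in>J. g a x \<in> B a}"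
    by (simp add: eq)
  also have "\<dots> = emeasure (distr Q (\<Pi>\<^sub>M a\<in>J. borel) (\<lambda>x. \<lambda>a\<in>J. g a x)) (Pi\<^sub>E J B)"
    by (auto simp: emeasure_distr Q.emeasure_eq_measure PiE_iff intro!: arg_cong2[where f=measure])
  finally show "emeasure (distr P (\<Pi>\<^sub>M a\<in>J. borel) (\<lambda>x. \<lambda>a\<in>J. f a x)) (Pi\<^sub>E J B)
    = emeasure (distr Q (\<Pi>\<^sub>M a\<in>J. borel) (\<lambda>x. \<lambda>a\<in>J. g a x)) (Pi\<^sub>E J B)" .
next
  interpret P: finite_measure P by fact
  interpret D: finite_measure "distr P (\<Pi>\<^sub>M a\<in>J. borel) (\<lambda>x. \<lambda>a\<in>J. f a x)"
    by (rule P.finite_measure_distr) simp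
  show "range (\<lambda>_::nat. space (\<Pi>\<^sub>M a\<in>J. borel)) \<subseteq> prod_algebra J (\<lambda>_. borel :: real measure)"
    using \<open>finite J\<close> by (auto simp: space_PiM intro!: prod_algebraI_finite)
  show "emeasure (distr P (\<Pi>\<^sub>M a\<in>J. borel) (\<lambda>x. \<lambda>a\<in>J. f a x)) (space (\<Pi>\<^sub>M a\<in>J. borel)) \<noteq> \<infinity>"
    by simp
qed simp_all

lemma distr_PiM_eqI_of_char_eq:
  fixes f :: "'i \<Rightarrow> 'a \<Rightarrow> real" and g :: "'i \<Rightarrow> 'b \<Rightarrow> real"
  assumes "finite J" "finite_measure P" "finite_measure Q"
    and "\<And>a. a \<in> J \<Longrightarrow> f a \<in> borel_measurable P" "\<And>a. a \<in> J \<Longrightarrow> g a \<in> borel_measurable Q"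
    and "\<And>u. (LINT x|P. iexp (\<Sum>a\<in>J. u a * f a x)) = (LINT x|Q. iexp (\<Sum>a\<in>J. u a * g a x))"
  shows "distr P (\<Pi>\<^sub>M a\<in>J. borel) (\<lambda>x. \<lambda>a\<in>J. f a x) = distr Q (\<Pi>\<^sub>M a\<in>J. borel) (\<lambda>x. \<lambda>a\<in>J. g a x)"
  using assms by (intro distr_PiM_eqI_of_rectangles joint_measure_eq_of_char_eq)

lemma distr_PiM_eqI_of_cdf_eq:
  fixes f :: "'i \<Rightarrow> 'a \<Rightarrow> real" and g :: "'i \<Rightarrow> 'b \<Rightarrow> real"
  assumes "finite J" "finite_measure P" "finite_measure Q"
    and "\<And>a. a \<in> J \<Longrightarrow> f a \<in> borel_measurable P" "\<And>a. a \<in> J \<Longrightarrow> g a \<in> borel_measurable Q"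
    and "\<And>v. measure P {x \<in> space P. \<forall>a\<in>J. f a x \<le> v a} = measure Q {x \<in> space Q. \<forall>a\<in>J. g a x \<le> v a}"
  shows "distr P (\<Pi>\<^sub>M a\<in>J. borel) (\<lambda>x. \<lambda>a\<in>J. f a x) = distr Q (\<Pi>\<^sub>M a\<in>J. borel) (\<lambda>x. \<lambda>a\<in>J. g a x)"
  using assms by (intro distr_PiM_eqI_of_rectangles joint_measure_eq_of_cdf_eq)

section \<open>Max moments and tilted characteristic functions\<close>

lemma integral_eq_of_tilted_distr_eq:
  fixes w :: "'a \<Rightarrow> real" and w' :: "'b \<Rightarrow> real" and H :: "'c \<Rightarrow> 'd :: {banach, second_countable_topology}"
  assumes "distr (density M (\<lambda>x. ennreal (w x))) L F = distr (density M' (\<lambda>x. ennreal (w' x))) L F'"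
    and [measurable]: "w \<in> borel_measurable M" "w' \<in> borel_measurable M'"
      "F \<in> measurable M L" "F' \<in> measurable M' L" "H \<in> borel_measurable L"
    and "\<And>x. 0 \<le> w x" "\<And>x. 0 \<le> w' x"
  shows "(LINT x|M. w x *\<^sub>R H (F x)) = (LINT x|M'. w' x *\<^sub>R H (F' x))"
proof -
  have "(LINT x|M. w x *\<^sub>R H (F x)) = integral\<^sup>L (distr (density M (\<lambda>x. ennreal (w x))) L F) H"
    using assms(7) by (simp add: integral_distr integral_density)
  also have "\<dots> = (LINT x|M'. w' x *\<^sub>R H (F' x))"
    unfolding assms(1) using assms(8) by (simp add: integral_distr integral_density)
  finally show ?thesis .
qed

lemma finite_measure_density_integrable:
  fixes w :: "'a \<Rightarrow> real"
  assumes "integrable M w" "\<And>x. 0 \<le> w x"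
  shows "finite_measure (density M (\<lambda>x. ennreal (w x)))"
  using assms by (intro finite_measureI)
    (simp add: emeasure_density nn_integral_eq_integral cong: nn_integral_cong)

lemma integrable_Max_scaled_exp:
  fixes X :: "'i \<Rightarrow> 'a \<Rightarrow> real"
  assumes I: "finite I" "I \<noteq> {}"
    and int: "\<And>a. a \<in> I \<Longrightarrow> integrable M (\<lambda>x. exp (X a x))"
    and c: "\<And>a. a \<in> I \<Longrightarrow> 0 < c a"
  shows "integrable M (\<lambda>x. Max ((\<lambda>a. c a * exp (X a x)) ` I))"
proof (rule Bochner_Integration.integrable_bound)
  show "integrable M (\<lambda>x. \<Sum>a\<in>I. c a * exp (X a x))"
    using int by auto
  have [measurable]: "(\<lambda>x. exp (X a x)) \<in> borel_measurable M" if "a \<in> I" for a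
    using int[OF that] by simp
  show "(\<lambda>x. Max ((\<lambda>a. c a * exp (X a x)) ` I)) \<in> borel_measurable M"
    using I by measurable
  show "AE x in M. norm (Max ((\<lambda>a. c a * exp (X a x)) ` I)) \<le> norm (\<Sum>a\<in>I. c a * exp (X a x))"
  proof (rule AE_I2)
    fix x
    have "Max ((\<lambda>a. c a * exp (X a x)) ` I) \<in> (\<lambda>a. c a * exp (X a x)) ` I"
      using I by (intro Max_in) auto
    then obtain a where "a \<in> I" "Max ((\<lambda>a. c a * exp (X a x)) ` I) = c a * exp (X a x)"
      by auto
    moreover from \<open>a \<in> I\<close> have "c a * exp (X a x) \<le> (\<Sum>a\<in>I. c a * exp (X a x))"
      using I c by (intro member_le_sum) (auto intro: less_imp_le)
    ultimately show "norm (Max ((\<lambda>a. c a * exp (X a x)) ` I)) \<le> norm (\<Sum>a\<in>I. c a * exp (X a x))"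
      using c[of a] by (simp add: abs_of_pos)
  qed
qed

text \<open>
  Raising one entry of a family raises its maximum exactly to the new entry, if at all. This makes the
  dependence of a max moment on a single weight explicit.
\<close>

lemma Max_image_fun_upd_increase:
  fixes F G :: "'i \<Rightarrow> real"
  assumes "finite I" "b \<in> I" "\<And>a. a \<in> I - {b} \<Longrightarrow> G a = F a" "F b \<le> G b"
  shows "Max (G ` I) = max (Max (F ` I)) (G b)"
proof (rule antisym)
  show "Max (G ` I) \<le> max (Max (F ` I)) (G b)"
  proof (rule Max.boundedI)
    fix r assume "r \<in> G ` I"
    then obtain a where a: "a \<in> I" "r = G a" by auto
    have "F a \<le> Max (F ` I)" using assms(1) a by auto
    with a assms(3)[of a] show "r \<le> max (Max (F ` I)) (G b)" by (cases "a = b") auto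
  qed (use assms in auto)
  have "F a \<le> Max (G ` I)" if "a \<in> I" for a
  proof -
    have "G a \<le> Max (G ` I)" using that assms(1) by auto
    then show ?thesis using assms(3)[of a] assms(4) that by (cases "a = b") auto
  qed
  then show "max (Max (F ` I)) (G b) \<le> Max (G ` I)"
    using assms(1,2) by (auto intro!: Max.boundedI)
qed

text \<open>
  With \<open>c\<^sub>a = exp (- v a)\<close> for \<open>a \<noteq> b\<close> and \<open>c\<^sub>b = 1\<close>, the maximum of \<open>c\<^sub>a exp X\<^sub>a\<close> is at least \<open>exp X\<^sub>b\<close>, with
  equality exactly if \<open>X\<^sub>a - X\<^sub>b \<le> v a\<close> for all \<open>a\<close>. Increasing \<open>c\<^sub>b\<close> to \<open>1 + h\<close> increases the maximum by
  \<open>h exp X\<^sub>b\<close> in the case of equality and by nothing for small \<open>h\<close> otherwise. The difference quotients are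
  dominated by \<open>exp X\<^sub>b\<close>. Hence the derivative is the distribution function of the differences under the
  tilted measure; the entry \<open>a = b\<close> of the family, where the difference is \<open>0\<close>, is harmless because
  \<open>v b \<ge> 0\<close>.
\<close>

lemma right_derivative_expectation_Max:
  fixes X :: "'i \<Rightarrow> 'a \<Rightarrow> real" and v :: "'i \<Rightarrow> real"
  assumes I: "finite I" "b \<in> I"
    and meas [measurable]: "\<And>a. a \<in> I \<Longrightarrow> X a \<in> borel_measurable M"
    and int: "\<And>a. a \<in> I \<Longrightarrow> integrable M (\<lambda>x. exp (X a x))"
    and v: "0 \<le> v b"
  defines "c \<equiv> (\<lambda>h a. if a = b then 1 + h else exp (- v a))"
  shows "(\<lambda>n. ((LINT x|M. Max ((\<lambda>a. c (1 / Suc n) a * exp (X a x)) ` I))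
               - (LINT x|M. Max ((\<lambda>a. c 0 a * exp (X a x)) ` I))) * Suc n)
    \<longlonglongrightarrow> measure (density M (\<lambda>x. ennreal (exp (X b x)))) {x \<in> space M. \<forall>a\<in>I. X a x - X b x \<le> v a}"
proof -
  define W where "W x = Max ((\<lambda>a. c 0 a * exp (X a x)) ` I)" for x
  define E where "E = {x \<in> space M. \<forall>a\<in>I. X a x - X b x \<le> v a}"
  have [measurable]: "X b \<in> borel_measurable M" using I by simp
  have [measurable]: "E \<in> sets M" using I(1) unfolding E_def by measurable
  have intW: "integrable M (\<lambda>x. Max ((\<lambda>a. c h a * exp (X a x)) ` I))" if "0 \<le> h" for h
    using I int that by (intro integrable_Max_scaled_exp) (auto simp: c_def)
  have [measurable]: "W \<in> borel_measurable M"
    using intW[of 0] by (simp add: W_def[abs_def])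
  have WI: "W x \<ge> exp (X b x)" for x
    using I by (auto simp: W_def c_def intro!: Max_ge image_eqI[where x=b])
  have upd: "Max ((\<lambda>a. c h a * exp (X a x)) ` I) = max (W x) ((1 + h) * exp (X b x))" if "0 \<le> h" for h x
    unfolding W_def using I that
    by (subst Max_image_fun_upd_increase[where b=b and F="\<lambda>a. c 0 a * exp (X a x)"]) (auto simp: c_def)
  have W_eq: "W x = exp (X b x) \<longleftrightarrow> (\<forall>a\<in>I. X a x - X b x \<le> v a)" for x
  proof -
    have "W x = exp (X b x) \<longleftrightarrow> W x \<le> exp (X b x)" using WI[of x] by auto
    also have "\<dots> \<longleftrightarrow> (\<forall>a\<in>I. c 0 a * exp (X a x) \<le> exp (X b x))"
      unfolding W_def using I by (subst Max_le_iff) auto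
    also have "\<dots> \<longleftrightarrow> (\<forall>a\<in>I. X a x - X b x \<le> v a)"
      using v by (intro ball_cong) (auto simp: c_def exp_add[symmetric])
    finally show ?thesis .
  qed
  \<comment> \<open>the difference quotient for the increment \<open>h = 1 / Suc n\<close> of the weight at \<open>b\<close>\<close>
  define D where "D n x = (max (W x) ((1 + 1 / Suc n) * exp (X b x)) - W x) * Suc n" for n x
  have lim: "(\<lambda>n. LINT x|M. D n x) \<longlonglongrightarrow> (LINT x|M. indicator E x * exp (X b x))"
  proof (rule integral_dominated_convergence[where w="\<lambda>x. exp (X b x)"])
    show "integrable M (\<lambda>x. exp (X b x))" using I int by auto
    show "AE x in M. (\<lambda>n. D n x) \<longlonglongrightarrow> indicator E x * exp (X b x)"
    proof (rule AE_I2)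
      fix x assume x: "x \<in> space M"
      show "(\<lambda>n. D n x) \<longlonglongrightarrow> indicator E x * exp (X b x)"
      proof (cases "x \<in> E")
        case True
        then have "W x = exp (X b x)" using W_eq by (auto simp: E_def)
        then have "D n x = exp (X b x)" for n
          unfolding D_def by (simp add: max_def field_simps)
        with True show ?thesis by simp
      next
        case False
        then have "W x \<noteq> exp (X b x)" using W_eq x by (auto simp: E_def)
        with WI[of x] have less: "exp (X b x) < W x" by simp
        have "(\<lambda>n. (1 + 1 / real (Suc n)) * exp (X b x)) \<longlonglongrightarrow> (1 + 0) * exp (X b x)"
          by (intro tendsto_intros LIMSEQ_Suc[OF lim_1_over_n])
        then have "eventually (\<lambda>n. (1 + 1 / real (Suc n)) * exp (X b x) < W x) sequentially"
          using less by (intro order_tendstoD) auto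
        then have "eventually (\<lambda>n. D n x = 0) sequentially"
          by eventually_elim (simp add: D_def max_def)
        with False show ?thesis by (simp add: tendsto_eventually)
      qed
    qed
    show "AE x in M. norm (D n x) \<le> exp (X b x)" for n
    proof (rule AE_I2)
      fix x
      have "max (W x) ((1 + 1 / Suc n) * exp (X b x)) - W x \<le> (1 / Suc n) * exp (X b x)"
        using WI[of x] by (auto simp: max_def algebra_simps)
      then have "D n x \<le> (1 / Suc n) * exp (X b x) * Suc n"
        unfolding D_def by (intro mult_right_mono) auto
      moreover have "0 \<le> D n x" by (simp add: D_def)
      ultimately show "norm (D n x) \<le> exp (X b x)" by simp
    qed
  qed (simp_all add: D_def)
  have D_int: "(LINT x|M. D n x) = ((LINT x|M. Max ((\<lambda>a. c (1 / Suc n) a * exp (X a x)) ` I))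
               - (LINT x|M. Max ((\<lambda>a. c 0 a * exp (X a x)) ` I))) * Suc n" for n
  proof -
    have "(LINT x|M. D n x) = (LINT x|M. (Max ((\<lambda>a. c (1 / Suc n) a * exp (X a x)) ` I)
        - Max ((\<lambda>a. c 0 a * exp (X a x)) ` I)) * Suc n)"
      by (simp only: D_def W_def[symmetric] upd[of "1 / real (Suc n)", OF divide_nonneg_nonneg[OF zero_le_one of_nat_0_le_iff]])
    also have "\<dots> = ((LINT x|M. Max ((\<lambda>a. c (1 / Suc n) a * exp (X a x)) ` I))
               - (LINT x|M. Max ((\<lambda>a. c 0 a * exp (X a x)) ` I))) * Suc n"
      by (subst integral_mult_left_zero, subst Bochner_Integration.integral_diff[OF intW intW]) auto
    finally show ?thesis .
  qed
  have "emeasure (density M (\<lambda>x. ennreal (exp (X b x)))) E = (\<integral>\<^sup>+x. ennreal (indicator E x * exp (X b x)) \<partial>M)"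
    by (subst emeasure_density) (auto intro!: nn_integral_cong simp: indicator_def)
  also have "\<dots> = ennreal (LINT x|M. indicator E x * exp (X b x))"
    using I int by (intro nn_integral_eq_integral integrable_mult_indicator[where 'b=real, unfolded real_scaleR_def]) auto
  finally have "measure (density M (\<lambda>x. ennreal (exp (X b x)))) E = (LINT x|M. indicator E x * exp (X b x))"
    by (simp add: measure_def integral_nonneg_AE)
  with lim show ?thesis
    by (simp only: D_int E_def)
qed

text \<open>
  Equal max moments have equal right derivatives, and these are the joint distribution functions of the
  two tilted vectors of differences. For \<open>v b < 0\<close> both distribution functions vanish, since the entry
  at \<open>b\<close> is constantly \<open>0\<close>.
\<close>

lemma tilted_law_eq_of_expectation_Max_eq:
  fixes X :: "'i \<Rightarrow> 'a \<Rightarrow> real" and Y :: "'i \<Rightarrow> 'b \<Rightarrow> real"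
  assumes I: "finite I" "b \<in> I"
    and measX [measurable]: "\<And>a. a \<in> I \<Longrightarrow> X a \<in> borel_measurable M"
    and measY [measurable]: "\<And>a. a \<in> I \<Longrightarrow> Y a \<in> borel_measurable M'"
    and intX: "\<And>a. a \<in> I \<Longrightarrow> integrable M (\<lambda>x. exp (X a x))"
    and intY: "\<And>a. a \<in> I \<Longrightarrow> integrable M' (\<lambda>x. exp (Y a x))"
    and eq: "\<And>c. (\<And>a. a \<in> I \<Longrightarrow> 0 < c a) \<Longrightarrow>
      (LINT x|M. Max ((\<lambda>a. c a * exp (X a x)) ` I)) = (LINT x|M'. Max ((\<lambda>a. c a * exp (Y a x)) ` I))"
  shows "distr (density M (\<lambda>x. ennreal (exp (X b x)))) (\<Pi>\<^sub>M a\<in>I. borel) (\<lambda>x. \<lambda>a\<in>I. X a x - X b x)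
       = distr (density M' (\<lambda>x. ennreal (exp (Y b x)))) (\<Pi>\<^sub>M a\<in>I. borel) (\<lambda>x. \<lambda>a\<in>I. Y a x - Y b x)"
proof (rule distr_PiM_eqI_of_cdf_eq)
  have [measurable]: "X b \<in> borel_measurable M" "Y b \<in> borel_measurable M'" using I by simp_all
  show "finite I" by fact
  show fin: "finite_measure (density M (\<lambda>x. ennreal (exp (X b x))))"
      "finite_measure (density M' (\<lambda>x. ennreal (exp (Y b x))))"
    using I intX intY by (auto intro!: finite_measure_density_integrable)
  show "(\<lambda>x. X a x - X b x) \<in> borel_measurable (density M (\<lambda>x. ennreal (exp (X b x))))"
       "(\<lambda>x. Y a x - Y b x) \<in> borel_measurable (density M' (\<lambda>x. ennreal (exp (Y b x))))" if "a \<in> I" for a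
    using that by simp_all
  fix v :: "'i \<Rightarrow> real"
  show "measure (density M (\<lambda>x. ennreal (exp (X b x)))) {x \<in> space (density M (\<lambda>x. ennreal (exp (X b x)))). \<forall>a\<in>I. X a x - X b x \<le> v a}
    = measure (density M' (\<lambda>x. ennreal (exp (Y b x)))) {x \<in> space (density M' (\<lambda>x. ennreal (exp (Y b x)))). \<forall>a\<in>I. Y a x - Y b x \<le> v a}"
  proof (cases "0 \<le> v b")
    case True
    note limX = right_derivative_expectation_Max[where X=X and v=v and M=M, OF I measX intX True]
    note limY = right_derivative_expectation_Max[where X=Y and v=v and M=M', OF I measY intY True]
    have "(LINT x|M. Max ((\<lambda>a. (if a = b then 1 + h else exp (- v a)) * exp (X a x)) ` I))
        = (LINT x|M'. Max ((\<lambda>a. (if a = b then 1 + h else exp (- v a)) * exp (Y a x)) ` I))" if "0 \<le> h" for h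
      using that by (intro eq) auto
    from this[of "1 / Suc n" for n] this[of 0] limX have
      "(\<lambda>n. ((LINT x|M'. Max ((\<lambda>a. (if a = b then 1 + 1 / Suc n else exp (- v a)) * exp (Y a x)) ` I))
             - (LINT x|M'. Max ((\<lambda>a. (if a = b then 1 + 0 else exp (- v a)) * exp (Y a x)) ` I))) * Suc n)
      \<longlonglongrightarrow> measure (density M (\<lambda>x. ennreal (exp (X b x)))) {x \<in> space M. \<forall>a\<in>I. X a x - X b x \<le> v a}"
      by (simp only: of_nat_0_le_iff zero_le_divide_1_iff order_refl)
    from LIMSEQ_unique[OF this limY] show ?thesis by simp
  next
    case False
    then have "{x \<in> space M. \<forall>a\<in>I. X a x - X b x \<le> v a} = {}" "{x \<in> space M'. \<forall>a\<in>I. Y a x - Y b x \<le> v a} = {}"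
      by (auto intro!: bexI[OF _ I(2)])
    then show ?thesis by (simp only: space_density measure_empty)
  qed
qed

text \<open>
  Let \<open>A = \<Sum> p\<^sub>a X\<^sub>a\<close>. A linear combination of the differences \<open>X\<^sub>a - A\<close> with arbitrary coefficients \<open>u\<close> is a
  linear combination of the \<open>X\<^sub>a\<close> with coefficients \<open>u\<^sub>a - (\<Sum> u) p\<^sub>a\<close> of sum zero. So the hypothesis is the
  equality of all characteristic functions of the vectors of differences under the tilt by \<open>exp A\<close>, and
  the maximum of \<open>c\<^sub>a exp X\<^sub>a\<close> is \<open>exp A\<close> times a function of this vector.
\<close>

lemma expectation_Max_eq_of_tilted_char_eq:
  fixes X :: "'i \<Rightarrow> 'a \<Rightarrow> real" and Y :: "'i \<Rightarrow> 'b \<Rightarrow> real"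
  assumes I: "finite I" and p: "\<And>a. a \<in> I \<Longrightarrow> 0 \<le> p a" "(\<Sum>a\<in>I. p a) = 1"
    and measX [measurable]: "\<And>a. a \<in> I \<Longrightarrow> X a \<in> borel_measurable M"
    and measY [measurable]: "\<And>a. a \<in> I \<Longrightarrow> Y a \<in> borel_measurable M'"
    and intX: "\<And>a. a \<in> I \<Longrightarrow> integrable M (\<lambda>x. exp (X a x))"
    and intY: "\<And>a. a \<in> I \<Longrightarrow> integrable M' (\<lambda>x. exp (Y a x))"
    and eq: "\<And>u. (\<Sum>a\<in>I. u a) = 0 \<Longrightarrow>
       (LINT x|M. exp (\<Sum>a\<in>I. p a * X a x) *\<^sub>R iexp (\<Sum>a\<in>I. u a * X a x))
     = (LINT x|M'. exp (\<Sum>a\<in>I. p a * Y a x) *\<^sub>R iexp (\<Sum>a\<in>I. u a * Y a x))"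
    and c: "\<And>a. a \<in> I \<Longrightarrow> 0 < c a"
  shows "(LINT x|M. Max ((\<lambda>a. c a * exp (X a x)) ` I)) = (LINT x|M'. Max ((\<lambda>a. c a * exp (Y a x)) ` I))"
proof -
  have "I \<noteq> {}" using p by auto
  define A where "A x = (\<Sum>a\<in>I. p a * X a x)" for x
  define B where "B x = (\<Sum>a\<in>I. p a * Y a x)" for x
  have [measurable]: "A \<in> borel_measurable M" "B \<in> borel_measurable M'"
    unfolding A_def B_def by measurable
  \<comment> \<open>a weighted mean is at most the maximum, so the tilt by \<open>exp A\<close> has finite mass\<close>
  have exp_mean_le: "exp (\<Sum>a\<in>I. p a * z a) \<le> (\<Sum>a\<in>I. exp (z a))" for z :: "'i \<Rightarrow> real"
  proof -
    have "(\<Sum>a\<in>I. p a * z a) \<le> (\<Sum>a\<in>I. p a * Max (z ` I))"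
      using I p by (intro sum_mono mult_left_mono) auto
    also have "\<dots> = Max (z ` I)" using p by (simp add: sum_distrib_right[symmetric])
    finally have "exp (\<Sum>a\<in>I. p a * z a) \<le> exp (Max (z ` I))" by simp
    also have "Max (z ` I) \<in> z ` I" using I \<open>I \<noteq> {}\<close> by (intro Max_in) auto
    then have "exp (Max (z ` I)) \<le> (\<Sum>a\<in>I. exp (z a))"
      using I by (auto intro!: member_le_sum)
    finally show ?thesis .
  qed
  have intA: "integrable M (\<lambda>x. exp (A x))"
    by (rule Bochner_Integration.integrable_bound[where f="\<lambda>x. \<Sum>a\<in>I. exp (X a x)"])
      (use intX exp_mean_le in \<open>auto simp: A_def sum_nonneg intro!: AE_I2\<close>)
  have intB: "integrable M' (\<lambda>x. exp (B x))"
    by (rule Bochner_Integration.integrable_bound[where f="\<lambda>x. \<Sum>a\<in>I. exp (Y a x)"])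
      (use intY exp_mean_le in \<open>auto simp: B_def sum_nonneg intro!: AE_I2\<close>)
  have lin: "(\<Sum>a\<in>I. u a * (z a - (\<Sum>a\<in>I. p a * z a))) = (\<Sum>a\<in>I. (u a - (\<Sum>a\<in>I. u a) * p a) * z a)" for u z :: "'i \<Rightarrow> real"
    by (simp add: right_diff_distrib left_diff_distrib sum_subtractf sum_distrib_left[symmetric]
        sum_distrib_right[symmetric] mult.assoc)
  have zero: "(\<Sum>a\<in>I. u a - (\<Sum>a\<in>I. u a) * p a) = 0" for u :: "'i \<Rightarrow> real"
    using p by (simp add: sum_subtractf sum_distrib_left[symmetric])
  have "distr (density M (\<lambda>x. ennreal (exp (A x)))) (\<Pi>\<^sub>M a\<in>I. borel) (\<lambda>x. \<lambda>a\<in>I. X a x - A x)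
       = distr (density M' (\<lambda>x. ennreal (exp (B x)))) (\<Pi>\<^sub>M a\<in>I. borel) (\<lambda>x. \<lambda>a\<in>I. Y a x - B x)"
  proof (rule distr_PiM_eqI_of_char_eq)
    show fin: "finite_measure (density M (\<lambda>x. ennreal (exp (A x))))"
        "finite_measure (density M' (\<lambda>x. ennreal (exp (B x))))"
      using intA intB by (auto intro!: finite_measure_density_integrable)
    show "finite I" by fact
    show m: "(\<lambda>x. X a x - A x) \<in> borel_measurable (density M (\<lambda>x. ennreal (exp (A x))))"
       "(\<lambda>x. Y a x - B x) \<in> borel_measurable (density M' (\<lambda>x. ennreal (exp (B x))))" if "a \<in> I" for a
      using that by simp_all
    fix u :: "'i \<Rightarrow> real"
    have "(LINT x|density M (\<lambda>x. ennreal (exp (A x))). iexp (\<Sum>a\<in>I. u a * (X a x - A x)))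
        = (LINT x|M. exp (A x) *\<^sub>R iexp (\<Sum>a\<in>I. (u a - (\<Sum>a\<in>I. u a) * p a) * X a x))"
      by (subst integral_density) (simp_all only: A_def lin; simp)+
    also have "\<dots> = (LINT x|M'. exp (B x) *\<^sub>R iexp (\<Sum>a\<in>I. (u a - (\<Sum>a\<in>I. u a) * p a) * Y a x))"
      unfolding A_def B_def by (rule eq) (rule zero)
    also have "\<dots> = (LINT x|density M' (\<lambda>x. ennreal (exp (B x))). iexp (\<Sum>a\<in>I. u a * (Y a x - B x)))"
      by (subst integral_density) (simp_all only: B_def lin; simp)+
    finally show "(LINT x|density M (\<lambda>x. ennreal (exp (A x))). iexp (\<Sum>a\<in>I. u a * (X a x - A x)))
      = (LINT x|density M' (\<lambda>x. ennreal (exp (B x))). iexp (\<Sum>a\<in>I. u a * (Y a x - B x)))" .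
  qed
  then have "(LINT x|M. exp (A x) *\<^sub>R Max ((\<lambda>a. c a * exp ((\<lambda>a\<in>I. X a x - A x) a)) ` I))
      = (LINT x|M'. exp (B x) *\<^sub>R Max ((\<lambda>a. c a * exp ((\<lambda>a\<in>I. Y a x - B x) a)) ` I))"
    by (rule integral_eq_of_tilted_distr_eq[where H="\<lambda>z. Max ((\<lambda>a. c a * exp (z a)) ` I)"])
      (use I in simp_all)
  moreover have "exp r *\<^sub>R Max ((\<lambda>a. c a * exp ((\<lambda>a\<in>I. z a - r) a)) ` I) = Max ((\<lambda>a. c a * exp (z a)) ` I)"
    for r and z :: "'i \<Rightarrow> real"
  proof -
    have "exp r * Max ((\<lambda>a. c a * exp (z a - r)) ` I) = Max ((\<lambda>t. exp r * t) ` (\<lambda>a. c a * exp (z a - r)) ` I)"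
      by (rule mono_Max_commute) (use I \<open>I \<noteq> {}\<close> in \<open>auto intro!: monoI\<close>)
    then show ?thesis by (simp add: image_image exp_diff cong: image_cong_simp)
  qed
  ultimately show ?thesis by simp
qed

text \<open>
  Because the coefficients \<open>p\<close> sum to \<open>1\<close> and the coefficients \<open>u\<close> to \<open>0\<close>, the integrand equals
  \<open>exp X\<^sub>b\<close> times a function \<open>H\<close> of the differences \<open>X\<^sub>a - X\<^sub>b\<close>, whose tilted law is already known to agree.
\<close>

lemma tilted_char_eq_of_expectation_Max_eq:
  fixes X :: "'i \<Rightarrow> 'a \<Rightarrow> real" and Y :: "'i \<Rightarrow> 'b \<Rightarrow> real"
  assumes I: "finite I" and p: "(\<Sum>a\<in>I. p a) = 1"
    and measX [measurable]: "\<And>a. a \<in> I \<Longrightarrow> X a \<in> borel_measurable M"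
    and measY [measurable]: "\<And>a. a \<in> I \<Longrightarrow> Y a \<in> borel_measurable M'"
    and intX: "\<And>a. a \<in> I \<Longrightarrow> integrable M (\<lambda>x. exp (X a x))"
    and intY: "\<And>a. a \<in> I \<Longrightarrow> integrable M' (\<lambda>x. exp (Y a x))"
    and eq: "\<And>c. (\<And>a. a \<in> I \<Longrightarrow> 0 < c a) \<Longrightarrow>
      (LINT x|M. Max ((\<lambda>a. c a * exp (X a x)) ` I)) = (LINT x|M'. Max ((\<lambda>a. c a * exp (Y a x)) ` I))"
    and u: "(\<Sum>a\<in>I. u a) = 0"
  shows "(LINT x|M. exp (\<Sum>a\<in>I. p a * X a x) *\<^sub>R iexp (\<Sum>a\<in>I. u a * X a x))
     = (LINT x|M'. exp (\<Sum>a\<in>I. p a * Y a x) *\<^sub>R iexp (\<Sum>a\<in>I. u a * Y a x))"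
proof -
  obtain b where b: "b \<in> I" using p by (cases "I = {}") auto
  then have [measurable]: "X b \<in> borel_measurable M" "Y b \<in> borel_measurable M'" by auto
  define H :: "('i \<Rightarrow> real) \<Rightarrow> complex" where
    "H z = exp (\<Sum>a\<in>I. p a * z a) *\<^sub>R iexp (\<Sum>a\<in>I. u a * z a)" for z
  have "(LINT x|M. exp (X b x) *\<^sub>R H (\<lambda>a\<in>I. X a x - X b x)) = (LINT x|M'. exp (Y b x) *\<^sub>R H (\<lambda>a\<in>I. Y a x - Y b x))"
    by (rule integral_eq_of_tilted_distr_eq[OF tilted_law_eq_of_expectation_Max_eq])
      (use I b intX intY eq in \<open>simp_all add: H_def\<close>)
  moreover have "exp r *\<^sub>R H (\<lambda>a\<in>I. z a - r) = exp (\<Sum>a\<in>I. p a * z a) *\<^sub>R iexp (\<Sum>a\<in>I. u a * z a)" for z r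
  proof -
    have "(\<Sum>a\<in>I. w a * (\<lambda>a\<in>I. z a - r) a) = (\<Sum>a\<in>I. w a * z a) - (\<Sum>a\<in>I. w a) * r" for w
      by (simp add: right_diff_distrib sum_subtractf sum_distrib_right cong: sum.cong_simp)
    then show ?thesis
      unfolding H_def by (simp only: p u) (simp add: exp_diff)
  qed
  ultimately show ?thesis by simp
qed

section \<open>The generating functional of a Poisson point process\<close>

text \<open>
  The Poisson weights sum to \<open>1\<close>, so almost surely the count is one of the natural numbers.
\<close>

lemma poisson_count_finite_AE:
  assumes ppp: "poisson_point_process N \<mu> y" and B: "B \<in> sets \<mu>" "emeasure \<mu> B < \<infinity>"
  shows "AE \<omega> in N. finite {i. y i \<omega> \<in> B}"
proof -
  interpret prob_space N using ppp by (simp add: poisson_point_process_def)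
  have y: "\<And>i. y i \<in> measurable N \<mu>" using ppp by (simp add: poisson_point_process_def)
  have [measurable]: "count_points y B \<in> borel_measurable N"
  proof -
    have "indep_vars (\<lambda>_. borel) (\<lambda>i. count_points y B) {..<1::nat}"
      using ppp B unfolding poisson_point_process_def
      by (elim conjE allE[where x="1::nat"] allE[where x="\<lambda>_. B"]) (simp add: disjoint_family_on_def)
    then show ?thesis by (auto simp: indep_vars_def)
  qed
  have pk: "prob {\<omega> \<in> space N. count_points y B \<omega> = of_nat k} = exp (- measure \<mu> B) * measure \<mu> B ^ k / fact k" for k
    using ppp B by (auto simp: poisson_point_process_def)
  have "(\<lambda>k. exp (- measure \<mu> B) * (measure \<mu> B ^ k /\<^sub>R fact k)) sums (exp (- measure \<mu> B) * exp (measure \<mu> B))"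
    by (intro sums_mult exp_converges)
  then have "(\<lambda>k. prob {\<omega> \<in> space N. count_points y B \<omega> = of_nat k}) sums 1"
    by (simp add: pk exp_minus divide_inverse mult_ac)
  moreover have "(\<lambda>k. prob {\<omega> \<in> space N. count_points y B \<omega> = of_nat k}) sums
      prob (\<Union>k. {\<omega> \<in> space N. count_points y B \<omega> = of_nat k})"
    by (rule finite_measure_UNION) (auto simp: disjoint_family_on_def)
  ultimately have "prob (\<Union>k. {\<omega> \<in> space N. count_points y B \<omega> = of_nat k}) = 1"
    using sums_unique2 by blast
  then have "AE \<omega> in N. \<omega> \<in> (\<Union>k. {\<omega> \<in> space N. count_points y B \<omega> = of_nat k})"
    by (subst prob_eq_1[symmetric]) auto
  then show ?thesis
    by eventually_elim (auto simp: count_points_def emeasure_count_space split: if_splits)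
qed

text \<open>
  For one set this is the exponential series for the generating function \<open>E q\<^sup>K = exp (- \<mu> (1 - q))\<close> of a
  Poisson variable; for several disjoint sets the counts are independent. Counts are written as
  cardinalities, which agree with \<open>count_points\<close> on the almost sure event that they are finite.
\<close>

lemma poisson_generating_function:
  fixes n :: nat
  assumes ppp: "poisson_point_process N \<mu> y"
    and B: "\<And>k. k < n \<Longrightarrow> B k \<in> sets \<mu>" "\<And>k. k < n \<Longrightarrow> emeasure \<mu> (B k) < \<infinity>"
    and disj: "disjoint_family_on B {..<n}"
    and q: "\<And>k. k < n \<Longrightarrow> 0 \<le> q k"
  shows "(\<integral>\<^sup>+\<omega>. ennreal (\<Prod>k<n. q k ^ card {i. y i \<omega> \<in> B k}) \<partial>N)
    = ennreal (\<Prod>k<n. exp (- (measure \<mu> (B k) * (1 - q k))))"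
proof -
  interpret prob_space N using ppp by (simp add: poisson_point_process_def)
  \<comment> \<open>\<open>q\<^sup>K\<close> as a function of the count; an infinite count, which has probability \<open>0\<close>, is treated as \<open>0\<close>\<close>
  define \<phi> where "\<phi> k x = ennreal (q k ^ nat \<lfloor>enn2real x\<rfloor>)" for k and x :: ennreal
  have \<phi>_meas [measurable]: "\<phi> k \<in> borel_measurable borel" for k
    unfolding \<phi>_def by measurable
  have ind: "indep_vars (\<lambda>_. borel) (\<lambda>k. count_points y (B k)) {..<n}"
    using ppp[unfolded poisson_point_process_def, THEN conjunct2, THEN conjunct2, THEN conjunct2,
        THEN conjunct2, rule_format, of n B] B(1) disj by simp
  then have [measurable]: "count_points y (B k) \<in> borel_measurable N" if "k < n" for k
    using that by (auto simp: indep_vars_def)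
  have fin: "AE \<omega> in N. \<forall>k<n. finite {i. y i \<omega> \<in> B k}"
    using poisson_count_finite_AE[OF ppp B] by (subst AE_all_countable) (auto simp: AE_all_countable)
  have \<phi>_card: "\<phi> k (count_points y (B k) \<omega>) = ennreal (q k ^ card {i. y i \<omega> \<in> B k})"
    if "finite {i. y i \<omega> \<in> B k}" for k \<omega>
    using that by (simp add: \<phi>_def count_points_def)
  have single: "(\<integral>\<^sup>+\<omega>. \<phi> k (count_points y (B k) \<omega>) \<partial>N) = ennreal (exp (- (measure \<mu> (B k) * (1 - q k))))"
    if k: "k < n" for k
  proof -
    have pk: "prob {\<omega> \<in> space N. count_points y (B k) \<omega> = of_nat j} = exp (- measure \<mu> (B k)) * measure \<mu> (B k) ^ j / fact j" for j
      using ppp B[OF k] by (simp add: poisson_point_process_def)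
    have "(\<integral>\<^sup>+\<omega>. \<phi> k (count_points y (B k) \<omega>) \<partial>N)
        = (\<integral>\<^sup>+\<omega>. (\<Sum>j. ennreal (q k ^ j) * indicator {\<omega> \<in> space N. count_points y (B k) \<omega> = of_nat j} \<omega>) \<partial>N)"
    proof (rule nn_integral_cong_AE)
      show "AE \<omega> in N. \<phi> k (count_points y (B k) \<omega>)
          = (\<Sum>j. ennreal (q k ^ j) * indicator {\<omega> \<in> space N. count_points y (B k) \<omega> = of_nat j} \<omega>)"
        using fin AE_space
      proof eventually_elim
        case (elim \<omega>)
        then have f: "finite {i. y i \<omega> \<in> B k}" using k by auto
        define c where "c = card {i. y i \<omega> \<in> B k}"
        have c: "count_points y (B k) \<omega> = of_nat j \<longleftrightarrow> j = c" for j
          using f by (auto simp: count_points_def c_def)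
        have "(\<Sum>j. ennreal (q k ^ j) * indicator {\<omega> \<in> space N. count_points y (B k) \<omega> = of_nat j} \<omega>)
            = (\<Sum>j\<in>{c}. ennreal (q k ^ j) * indicator {\<omega> \<in> space N. count_points y (B k) \<omega> = of_nat j} \<omega>)"
          by (intro suminf_finite) (auto simp: c)
        also have "\<dots> = ennreal (q k ^ c)"
          using elim(2) by (simp add: c)
        also have "\<dots> = \<phi> k (count_points y (B k) \<omega>)"
          unfolding \<phi>_card[OF f] c_def ..
        finally show ?case by simp
      qed
    qed
    also have "\<dots> = (\<Sum>j. \<integral>\<^sup>+\<omega>. ennreal (q k ^ j) * indicator {\<omega> \<in> space N. count_points y (B k) \<omega> = of_nat j} \<omega> \<partial>N)"
      using k by (intro nn_integral_suminf) measurable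
    also have "\<dots> = (\<Sum>j. ennreal (exp (- measure \<mu> (B k)) * ((q k * measure \<mu> (B k)) ^ j /\<^sub>R fact j)))"
      using k q[OF k]
      by (intro suminf_cong) (simp add: nn_integral_cmult_indicator emeasure_eq_measure pk ennreal_mult'[symmetric]
          power_mult_distrib divide_inverse mult_ac)
    also have "\<dots> = ennreal (exp (- measure \<mu> (B k)) * exp (q k * measure \<mu> (B k)))"
      using q[OF k] by (intro suminf_ennreal_eq sums_mult exp_converges) auto
    also have "exp (- measure \<mu> (B k)) * exp (q k * measure \<mu> (B k)) = exp (- (measure \<mu> (B k) * (1 - q k)))"
      by (simp add: exp_add[symmetric] algebra_simps)
    finally show ?thesis .
  qed
  have "(\<integral>\<^sup>+\<omega>. ennreal (\<Prod>k<n. q k ^ card {i. y i \<omega> \<in> B k}) \<partial>N)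
      = (\<integral>\<^sup>+\<omega>. (\<Prod>k<n. \<phi> k (count_points y (B k) \<omega>)) \<partial>N)"
  proof (rule nn_integral_cong_AE)
    show "AE \<omega> in N. ennreal (\<Prod>k<n. q k ^ card {i. y i \<omega> \<in> B k}) = (\<Prod>k<n. \<phi> k (count_points y (B k) \<omega>))"
      using fin
    proof eventually_elim
      case (elim \<omega>)
      then have "(\<Prod>k<n. \<phi> k (count_points y (B k) \<omega>)) = (\<Prod>k<n. ennreal (q k ^ card {i. y i \<omega> \<in> B k}))"
        by (intro prod.cong) (auto simp: \<phi>_card)
      also have "\<dots> = ennreal (\<Prod>k<n. q k ^ card {i. y i \<omega> \<in> B k})"
        by (rule prod_ennreal) (use q in auto)
      finally show ?case by simp
    qed
  qed
  also have "\<dots> = (\<Prod>k<n. \<integral>\<^sup>+\<omega>. \<phi> k (count_points y (B k) \<omega>) \<partial>N)"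
    by (rule indep_vars_nn_integral) (auto intro!: indep_vars_compose2[OF ind])
  also have "\<dots> = ennreal (\<Prod>k<n. exp (- (measure \<mu> (B k) * (1 - q k))))"
    by (simp add: single prod_ennreal)
  finally show ?thesis .
qed

text \<open>
  A simple integrable \<open>g\<close> takes its nonzero values \<open>v k\<close> on disjoint sets \<open>B k\<close> of finite intensity. Almost
  surely only finitely many points lie in these sets, so the partial products are eventually constant and
  equal to the product of the powers \<open>(1 - v k)\<^sup>K\<close>, where \<open>K\<close> is the number of points in \<open>B k\<close>.
\<close>

lemma poisson_generating_functional_simple:
  fixes g :: "'a \<Rightarrow> real"
  assumes ppp: "poisson_point_process N \<mu> y"
    and g: "simple_function \<mu> g" "\<And>x. 0 \<le> g x" "\<And>x. g x \<le> 1" "integrable \<mu> g"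
  shows "(\<lambda>m. LINT \<omega>|N. (\<Prod>i<m. (1 - g (y i \<omega>)))) \<longlonglongrightarrow> exp (- (LINT x|\<mu>. g x))"
proof -
  interpret prob_space N using ppp by (simp add: poisson_point_process_def)
  have y [measurable]: "\<And>i. y i \<in> measurable N \<mu>" using ppp by (simp add: poisson_point_process_def)
  have [measurable]: "g \<in> borel_measurable \<mu>" using g(4) by simp
  have "finite (g ` space \<mu> - {0})" using g(1) by (simp add: simple_function_def)
  then obtain v where "bij_betw v {0..<card (g ` space \<mu> - {0})} (g ` space \<mu> - {0})"
    using ex_bij_betw_nat_finite by blast
  then obtain n where v: "bij_betw v {..<n} (g ` space \<mu> - {0})"
    by (auto simp: atLeast0LessThan)
  define B where "B k = {x \<in> space \<mu>. g x = v k}" for k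
  have B_meas [measurable]: "B k \<in> sets \<mu>" for k by (simp add: B_def)
  have vk: "0 < v k" "v k \<le> 1" if "k < n" for k
  proof -
    have "v k \<in> g ` space \<mu> - {0}" using v that by (auto simp: bij_betw_def)
    then show "0 < v k" "v k \<le> 1" using g(2,3) by (auto simp: less_le)
  qed
  have B_fin: "emeasure \<mu> (B k) < \<infinity>" if "k < n" for k
  proof -
    have "ennreal (v k) * emeasure \<mu> (B k) = (\<integral>\<^sup>+x. ennreal (v k) * indicator (B k) x \<partial>\<mu>)"
      by (simp add: nn_integral_cmult_indicator)
    also have "\<dots> \<le> (\<integral>\<^sup>+x. ennreal (g x) \<partial>\<mu>)"
      by (intro nn_integral_mono) (auto simp: B_def indicator_def)
    also have "\<dots> < \<infinity>"
      using g(2,4) by (simp add: nn_integral_eq_integral)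
    finally show ?thesis
      using vk[OF that] by (auto simp: ennreal_mult_less_top)
  qed
  have inj: "v j = v k \<longleftrightarrow> j = k" if "j < n" "k < n" for j k
    using v that by (auto simp: bij_betw_def inj_on_def)
  have disj: "disjoint_family_on B {..<n}"
    using inj by (auto simp: disjoint_family_on_def B_def)
  have val: "(\<exists>k<n. x \<in> B k \<and> g x = v k) \<or> ((\<forall>k<n. x \<notin> B k) \<and> g x = 0)" if "x \<in> space \<mu>" for x
  proof (cases "g x = 0")
    case True
    then show ?thesis using vk by (auto simp: B_def)
  next
    case False
    then have "g x \<in> v ` {..<n}" using v that by (auto simp: bij_betw_def)
    then show ?thesis using that by (auto simp: B_def)
  qed
  have prod_form: "1 - g x = (\<Prod>k<n. if x \<in> B k then 1 - v k else 1)" if "x \<in> space \<mu>" for x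
    using val[OF that]
  proof
    assume "\<exists>k<n. x \<in> B k \<and> g x = v k"
    then obtain k where k: "k < n" "x \<in> B k" "g x = v k" by auto
    then have "(\<Prod>j<n. if x \<in> B j then 1 - v j else 1) = (\<Prod>j<n. if j = k then 1 - v j else 1)"
      using inj by (intro prod.cong) (auto simp: B_def)
    with k show ?thesis by simp
  qed simp
  have sum_form: "g x = (\<Sum>k<n. v k * indicator (B k) x)" if "x \<in> space \<mu>" for x
    using val[OF that]
  proof
    assume "\<exists>k<n. x \<in> B k \<and> g x = v k"
    then obtain k where k: "k < n" "x \<in> B k" "g x = v k" by auto
    then have "(\<Sum>j<n. v j * indicator (B j) x) = (\<Sum>j<n. if j = k then v j else 0)"
      using inj by (intro sum.cong) (auto simp: B_def)
    with k show ?thesis by simp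
  qed simp
  have intg: "(LINT x|\<mu>. g x) = (\<Sum>k<n. v k * measure \<mu> (B k))"
  proof -
    have "(LINT x|\<mu>. g x) = (LINT x|\<mu>. (\<Sum>k<n. v k * indicator (B k) x))"
      by (rule Bochner_Integration.integral_cong) (auto simp: sum_form)
    also have "\<dots> = (\<Sum>k<n. LINT x|\<mu>. v k * indicator (B k) x)"
      using B_fin by (intro Bochner_Integration.integral_sum) auto
    finally show ?thesis by simp
  qed
  define L where "L \<omega> = (\<Prod>k<n. (1 - v k) ^ card {i. y i \<omega> \<in> B k})" for \<omega>
  have fin: "AE \<omega> in N. \<forall>k<n. finite {i. y i \<omega> \<in> B k}"
    using poisson_count_finite_AE[OF ppp B_meas B_fin] by (subst AE_all_countable) (auto simp: AE_all_countable)
  have L_lim: "AE \<omega> in N. (\<lambda>m. \<Prod>i<m. (1 - g (y i \<omega>))) \<longlonglongrightarrow> L \<omega>"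
    using fin AE_space
  proof eventually_elim
    case (elim \<omega>)
    have ysp: "y i \<omega> \<in> space \<mu>" for i using elim y[of i] by (auto simp: measurable_def)
    have "(\<Prod>i<m. (1 - g (y i \<omega>))) = (\<Prod>k<n. (1 - v k) ^ card {i\<in>{..<m}. y i \<omega> \<in> B k})" for m
    proof -
      have "(\<Prod>i<m. (1 - g (y i \<omega>))) = (\<Prod>i<m. \<Prod>k<n. if y i \<omega> \<in> B k then 1 - v k else 1)"
        by (simp add: prod_form ysp)
      also have "\<dots> = (\<Prod>k<n. \<Prod>i<m. if y i \<omega> \<in> B k then 1 - v k else 1)"
        by (rule prod.swap)
      finally show ?thesis by (simp add: prod.If_cases Int_def)
    qed
    moreover have "(\<lambda>m. \<Prod>k<n. (1 - v k) ^ card {i\<in>{..<m}. y i \<omega> \<in> B k}) \<longlonglongrightarrow> L \<omega>"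
      unfolding L_def
    proof (rule tendsto_prod)
      fix k assume "k \<in> {..<n}"
      then have "finite {i. y i \<omega> \<in> B k}" using elim by auto
      then obtain m0 where "\<forall>i\<in>{i. y i \<omega> \<in> B k}. i < m0"
        using finite_nat_set_iff_bounded by blast
      then have "{i\<in>{..<m}. y i \<omega> \<in> B k} = {i. y i \<omega> \<in> B k}" if "m \<ge> m0" for m
        using that by force
      then show "(\<lambda>m. (1 - v k) ^ card {i\<in>{..<m}. y i \<omega> \<in> B k}) \<longlonglongrightarrow> (1 - v k) ^ card {i. y i \<omega> \<in> B k}"
        by (intro tendsto_eventually eventually_sequentiallyI[of m0]) simp
    qed
    ultimately show ?case by simp
  qed
  have prod01: "0 \<le> (\<Prod>i<m. (1 - g (y i \<omega>)))" "(\<Prod>i<m. (1 - g (y i \<omega>))) \<le> 1" for m \<omega>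
    using g(2,3) by (auto intro!: prod_nonneg prod_le_1)
  define L' where "L' \<omega> = lim (\<lambda>m. \<Prod>i<m. (1 - g (y i \<omega>)))" for \<omega>
  have [measurable]: "L' \<in> borel_measurable N" unfolding L'_def by measurable
  have L'L: "AE \<omega> in N. L' \<omega> = L \<omega>"
    using L_lim by eventually_elim (simp add: L'_def limI)
  have "(\<lambda>m. LINT \<omega>|N. (\<Prod>i<m. (1 - g (y i \<omega>)))) \<longlonglongrightarrow> (LINT \<omega>|N. L' \<omega>)"
  proof (rule integral_dominated_convergence[where w="\<lambda>_. 1"])
    show "AE \<omega> in N. (\<lambda>m. \<Prod>i<m. (1 - g (y i \<omega>))) \<longlonglongrightarrow> L' \<omega>"
      using L_lim L'L by eventually_elim simp
  qed (use prod01 in auto)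
  also have "(LINT \<omega>|N. L' \<omega>) = exp (- (LINT x|\<mu>. g x))"
  proof -
    have Lpos: "0 \<le> L \<omega>" for \<omega> unfolding L_def using vk by (auto intro!: prod_nonneg)
    have "(\<integral>\<^sup>+\<omega>. ennreal (L' \<omega>) \<partial>N) = (\<integral>\<^sup>+\<omega>. ennreal (L \<omega>) \<partial>N)"
      by (rule nn_integral_cong_AE) (use L'L in eventually_elim, simp)
    also have "\<dots> = ennreal (\<Prod>k<n. exp (- (measure \<mu> (B k) * (1 - (1 - v k)))))"
      unfolding L_def using vk by (intro poisson_generating_function[OF ppp] B_fin disj) auto
    also have "(\<Prod>k<n. exp (- (measure \<mu> (B k) * (1 - (1 - v k))))) = exp (- (LINT x|\<mu>. g x))"
      by (simp add: intg exp_sum[symmetric] sum_negf mult.commute)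
    finally show ?thesis
      using L'L Lpos by (intro integral_eq_nn_integral[THEN trans]) (auto elim: eventually_mono)
  qed
  finally show ?thesis .
qed

text \<open>
  Two monotone limits can be interchanged. It is used with the number of factors as first and the
  approximation index as second parameter.
\<close>

lemma decreasing_double_limit:
  fixes a :: "nat \<Rightarrow> nat \<Rightarrow> real"
  assumes decm: "\<And>m m' j. m \<le> m' \<Longrightarrow> a m' j \<le> a m j" and decj: "\<And>m j j'. j \<le> j' \<Longrightarrow> a m j' \<le> a m j"
    and b: "\<And>m. a m \<longlonglongrightarrow> b m" and c: "\<And>j. (\<lambda>m. a m j) \<longlonglongrightarrow> c j" and l: "c \<longlonglongrightarrow> l"
  shows "b \<longlonglongrightarrow> l"
proof -
  have b_le: "b m \<le> a m j" for m j
    using b[of m] decj by (intro decseq_ge) (auto simp: decseq_def)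
  have c_le: "c j \<le> a m j" for m j
    using c[of j] decm by (intro decseq_ge[where X="\<lambda>m. a m j"]) (auto simp: decseq_def)
  have l_le: "l \<le> b m" for m
    by (rule LIMSEQ_le[OF l b[of m]]) (use c_le in auto)
  show ?thesis
  proof (rule order_tendstoI)
    fix r assume "r < l"
    then show "eventually (\<lambda>m. r < b m) sequentially"
      using l_le by (intro always_eventually) (auto intro: less_le_trans)
  next
    fix r assume "l < r"
    then have "eventually (\<lambda>j. c j < r) sequentially" using l by (auto intro: order_tendstoD)
    then obtain j where "c j < r" by (auto simp: eventually_sequentially)
    then have "eventually (\<lambda>m. a m j < r) sequentially" using c[of j] by (auto intro: order_tendstoD)
    then show "eventually (\<lambda>m. b m < r) sequentially"
      by eventually_elim (use b_le[of _ j] in \<open>auto intro: le_less_trans\<close>)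
  qed
qed

text \<open>
  The probability generating functional of a Poisson process. It is stated as a limit of expectations of
  finite products, which is the form in which the marks are integrated out later. The partial products
  decrease in the number of points and, along simple functions increasing to \<open>g\<close>, also in the
  approximation.
\<close>

lemma poisson_generating_functional:
  fixes g :: "'a \<Rightarrow> real"
  assumes ppp: "poisson_point_process N \<mu> y"
    and g: "\<And>x. 0 \<le> g x" "\<And>x. g x \<le> 1" "integrable \<mu> g"
  shows "(\<lambda>m. LINT \<omega>|N. (\<Prod>i<m. (1 - g (y i \<omega>)))) \<longlonglongrightarrow> exp (- (LINT x|\<mu>. g x))"
proof -
  interpret prob_space N using ppp by (simp add: poisson_point_process_def)
  have y [measurable]: "\<And>i. y i \<in> measurable N \<mu>" using ppp by (simp add: poisson_point_process_def)
  have g_meas [measurable]: "g \<in> borel_measurable \<mu>" using g(3) by simp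
  obtain U where U: "\<And>j. simple_function \<mu> (U j)" "incseq U" "\<And>x. bdd_above (range (\<lambda>j. U j x))"
      "\<And>j x. 0 \<le> U j x" and gU: "g = (SUP j. U j)"
    using borel_measurable_implies_simple_function_sequence_real[OF g_meas g(1)] by metis
  have [measurable]: "U j \<in> borel_measurable \<mu>" for j
    using U(1) by (rule borel_measurable_simple_function)
  have g_SUP: "g x = (SUP j. U j x)" for x unfolding gU by (simp add: image_image)
  have U_le: "U j x \<le> g x" for j x
    unfolding g_SUP using U(3)[of x] by (intro cSUP_upper) auto
  have U_mono: "U j x \<le> U j' x" if "j \<le> j'" for j j' x
    using U(2) that by (auto simp: incseq_def le_fun_def)
  have U_lim: "(\<lambda>j. U j x) \<longlonglongrightarrow> g x" for x
    unfolding g_SUP using U(3)[of x] U_mono by (intro LIMSEQ_incseq_SUP) (auto simp: incseq_def)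
  have U01: "0 \<le> 1 - U j x" "1 - U j x \<le> 1" for j x
    using U(4)[of j x] U_le[of j x] g(2)[of x] by auto
  have prod01: "0 \<le> (\<Prod>i<m. (1 - U j (z i)))" "(\<Prod>i<m. (1 - U j (z i))) \<le> 1" for m :: nat and j z
    using U01 by (auto intro!: prod_nonneg prod_le_1)
  have norm_prod: "norm (\<Prod>i<m. (1 - U j (z i))) \<le> 1" for m :: nat and j z
    by (simp add: prod01)
  have intprod: "integrable N (\<lambda>\<omega>. \<Prod>i<m. (1 - U j (y i \<omega>)))" for m j
    by (rule integrable_const_bound[OF AE_I2[OF norm_prod]]) simp
  have norm_U: "norm (U j x) \<le> g x" for j x
    using U(4)[of j x] U_le[of j x] by simp
  have intU: "integrable \<mu> (U j)" for j
    by (rule Bochner_Integration.integrable_bound[OF g(3)])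
      (auto intro!: AE_I2 order_trans[OF norm_U[unfolded real_norm_def] abs_ge_self])
  have prod_dec: "(\<Prod>i<m'. (1 - U j (z i))) \<le> (\<Prod>i<m. (1 - U j (z i)))" if "m \<le> m'" for m m' :: nat and j z
  proof -
    have "decseq (\<lambda>m. \<Prod>i<m. (1 - U j (z i)))"
    proof (rule decseq_SucI)
      fix m
      show "(\<Prod>i<Suc m. (1 - U j (z i))) \<le> (\<Prod>i<m. (1 - U j (z i)))"
        using mult_left_le[OF U01(2)[of j "z m"] prod01(1)] by simp
    qed
    then show ?thesis using that by (rule decseqD)
  qed
  show ?thesis
  proof (rule decreasing_double_limit[where a="\<lambda>m j. LINT \<omega>|N. (\<Prod>i<m. (1 - U j (y i \<omega>)))"
        and c="\<lambda>j. exp (- (LINT x|\<mu>. U j x))"])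
    show "(LINT \<omega>|N. (\<Prod>i<m'. (1 - U j (y i \<omega>)))) \<le> (LINT \<omega>|N. (\<Prod>i<m. (1 - U j (y i \<omega>))))"
      if "m \<le> m'" for m m' j
      using that by (intro integral_mono intprod prod_dec)
    show "(LINT \<omega>|N. (\<Prod>i<m. (1 - U j' (y i \<omega>)))) \<le> (LINT \<omega>|N. (\<Prod>i<m. (1 - U j (y i \<omega>))))"
      if "j \<le> j'" for m j j'
      by (intro integral_mono intprod prod_mono conjI U01 diff_left_mono U_mono that)
    show "(\<lambda>j. LINT \<omega>|N. (\<Prod>i<m. (1 - U j (y i \<omega>)))) \<longlonglongrightarrow> (LINT \<omega>|N. (\<Prod>i<m. (1 - g (y i \<omega>))))" for m
    proof (rule integral_dominated_convergence[where w="\<lambda>_. 1"])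
      show "AE \<omega> in N. (\<lambda>j. \<Prod>i<m. (1 - U j (y i \<omega>))) \<longlonglongrightarrow> (\<Prod>i<m. (1 - g (y i \<omega>)))"
        by (intro AE_I2 tendsto_intros U_lim)
      show "AE \<omega> in N. norm (\<Prod>i<m. (1 - U j (y i \<omega>))) \<le> 1" for j
        by (intro AE_I2 norm_prod)
    qed simp_all
    show "(\<lambda>m. LINT \<omega>|N. (\<Prod>i<m. (1 - U j (y i \<omega>)))) \<longlonglongrightarrow> exp (- (LINT x|\<mu>. U j x))" for j
    proof (rule poisson_generating_functional_simple[OF ppp])
      show "U j x \<le> 1" for x using U01(1)[of j x] by simp
    qed (intro U intU)+
    show "(\<lambda>j. exp (- (LINT x|\<mu>. U j x))) \<longlonglongrightarrow> exp (- (LINT x|\<mu>. g x))"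
    proof (intro tendsto_intros integral_dominated_convergence[where w=g] g(3))
      show "AE x in \<mu>. (\<lambda>j. U j x) \<longlonglongrightarrow> g x" by (intro AE_I2 U_lim)
      show "AE x in \<mu>. norm (U j x) \<le> g x" for j by (intro AE_I2 norm_U)
    qed simp_all
  qed
qed

section \<open>Independently marked points\<close>

text \<open>
  Independence of the generated sigma-algebras means that the joint law is the product of the laws. This
  version covers two random elements with values in different types.
\<close>

lemma (in prob_space) distr_pair_of_indep_vimage_algebras:
  assumes Y [measurable]: "Y \<in> measurable M A" and Z [measurable]: "Z \<in> measurable M B"
    and ind: "indep_set (sets (vimage_algebra (space M) Y A)) (sets (vimage_algebra (space M) Z B))"
  shows "distr M (A \<Otimes>\<^sub>M B) (\<lambda>\<omega>. (Y \<omega>, Z \<omega>)) = distr M A Y \<Otimes>\<^sub>M distr M B Z"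
proof (rule pair_measure_eqI[symmetric])
  interpret Y: prob_space "distr M A Y" by (rule prob_space_distr) fact
  interpret Z: prob_space "distr M B Z" by (rule prob_space_distr) fact
  show "sigma_finite_measure (distr M A Y)" "sigma_finite_measure (distr M B Z)"
    by unfold_locales
  show "sets (distr M A Y \<Otimes>\<^sub>M distr M B Z) = sets (distr M (A \<Otimes>\<^sub>M B) (\<lambda>\<omega>. (Y \<omega>, Z \<omega>)))"
    by (simp cong: sets_pair_measure_cong)
  fix a b assume ab: "a \<in> sets (distr M A Y)" "b \<in> sets (distr M B Z)"
  then have [measurable]: "a \<in> sets A" "b \<in> sets B" by simp_all
  have "prob ((Y -` a \<inter> space M) \<inter> (Z -` b \<inter> space M)) = prob (Y -` a \<inter> space M) * prob (Z -` b \<inter> space M)"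
    by (rule indep_setD[OF ind]) (auto intro: in_vimage_algebra)
  moreover have "(\<lambda>\<omega>. (Y \<omega>, Z \<omega>)) -` (a \<times> b) \<inter> space M = (Y -` a \<inter> space M) \<inter> (Z -` b \<inter> space M)"
    by auto
  ultimately show "emeasure (distr M A Y) a * emeasure (distr M B Z) b
      = emeasure (distr M (A \<Otimes>\<^sub>M B) (\<lambda>\<omega>. (Y \<omega>, Z \<omega>))) (a \<times> b)"
    by (simp add: emeasure_distr emeasure_eq_measure ennreal_mult[symmetric])
qed

text \<open>
  Conditionally on the points, the marks are still independent with law \<open>Q\<close>, so each point \<open>y i\<close> contributes
  the factor \<open>Q {p. R (y i) p}\<close>. Formally this is Fubini's theorem for the joint law of the sequence of
  points and the sequence of marks, which is a product measure.
\<close>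

lemma prob_marks_of_points:
  fixes y :: "nat \<Rightarrow> 'w \<Rightarrow> real" and \<Xi> :: "nat \<Rightarrow> 'w \<Rightarrow> 'p"
  assumes "prob_space N"
    and y [measurable]: "\<And>i. y i \<in> borel_measurable N"
    and ind: "prob_space.indep_vars N (\<lambda>_. S) \<Xi> UNIV"
    and law: "\<And>i. distr N S (\<Xi> i) = Q"
    and indep: "prob_space.indep_set N
       (sets (vimage_algebra (space N) (\<lambda>\<omega> i. y i \<omega>) (\<Pi>\<^sub>M i\<in>UNIV. borel)))
       (sets (vimage_algebra (space N) (\<lambda>\<omega> i. \<Xi> i \<omega>) (\<Pi>\<^sub>M i\<in>UNIV. S)))"
    and R: "Measurable.pred (borel \<Otimes>\<^sub>M S) (\<lambda>p. R (fst p) (snd p))"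
  shows "measure N {\<omega> \<in> space N. \<forall>i<m. R (y i \<omega>) (\<Xi> i \<omega>)}
    = (LINT \<omega>|N. (\<Prod>i<m. measure Q {p \<in> space S. R (y i \<omega>) p}))"
proof -
  interpret prob_space N by fact
  have \<Xi> [measurable]: "\<Xi> i \<in> measurable N S" for i
    using ind by (simp add: indep_vars_def)
  interpret Q: prob_space Q
    unfolding law[of 0, symmetric] by (rule prob_space_distr) simp
  have setsQ [measurable_cong]: "sets Q = sets S" by (simp add: law[of 0, symmetric])
  have spaceQ: "space Q = space S" by (simp add: law[of 0, symmetric])
  define Y where "Y \<omega> i = y i \<omega>" for \<omega> i
  define Z where "Z \<omega> i = \<Xi> i \<omega>" for \<omega> i
  have Y_meas [measurable]: "Y \<in> measurable N (\<Pi>\<^sub>M i\<in>UNIV. borel)"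
    unfolding Y_def[abs_def] by (rule measurable_abs_UNIV) simp
  have Z_meas [measurable]: "Z \<in> measurable N (\<Pi>\<^sub>M i\<in>UNIV. S)"
    unfolding Z_def[abs_def] by (rule measurable_abs_UNIV) simp
  let ?A = "\<Pi>\<^sub>M i\<in>(UNIV::nat set). (borel :: real measure)" and ?B = "\<Pi>\<^sub>M i\<in>(UNIV::nat set). S"
  interpret Y: prob_space "distr N ?A Y" by (rule prob_space_distr) simp
  interpret Z: prob_space "distr N ?B Z" by (rule prob_space_distr) simp
  have R_sec [measurable]: "Measurable.pred S (R r)" for r
    using measurable_compose[OF measurable_Pair1' R, of r] by simp
  have R1 [measurable]: "Measurable.pred (?A \<Otimes>\<^sub>M ?B) (\<lambda>p. R (fst p i) (snd p i))" for i
  proof -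
    have "(\<lambda>p. (fst p i, snd p i)) \<in> measurable (?A \<Otimes>\<^sub>M ?B) (borel \<Otimes>\<^sub>M S)" by measurable
    from measurable_compose[OF this R] show ?thesis by simp
  qed
  have R2 [measurable]: "Measurable.pred N (\<lambda>\<omega>. R (y i \<omega>) (\<Xi> i \<omega>))" for i
    using measurable_compose[OF measurable_Pair[OF y \<Xi>] R] by simp
  have R3 [measurable]: "Measurable.pred ?B (\<lambda>zs. R r (zs i))" for r i
  proof -
    have "(\<lambda>zs. zs i) \<in> measurable ?B S" by measurable
    from measurable_compose[OF this R_sec] show ?thesis by simp
  qed
  have R4 [measurable]: "Measurable.pred N (\<lambda>\<omega>. R r (\<Xi> i \<omega>))" for r i
    using measurable_compose[OF \<Xi> R_sec] by simp
  define T where "T = {p \<in> space (?A \<Otimes>\<^sub>M ?B). \<forall>i<m. R (fst p i) (snd p i)}"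
  have T [measurable]: "T \<in> sets (?A \<Otimes>\<^sub>M ?B)" unfolding T_def by measurable
  have Q_meas: "(\<lambda>r. measure Q {p \<in> space S. R r p}) \<in> borel_measurable borel"
  proof -
    have "{p \<in> space (borel \<Otimes>\<^sub>M S). R (fst p) (snd p)} \<in> sets (borel \<Otimes>\<^sub>M Q)"
      using R unfolding pred_def by (simp cong: sets_pair_measure_cong add: setsQ)
    from Q.measurable_emeasure_Pair[OF this]
    have "(\<lambda>r. emeasure Q {p \<in> space S. R r p}) \<in> borel_measurable borel"
      by (rule measurable_cong[THEN iffD1, rotated]) (auto intro!: arg_cong2[where f=emeasure] simp: space_pair_measure)
    then show ?thesis unfolding measure_def by measurable
  qed
  have [measurable]: "(\<lambda>\<omega>. measure Q {p \<in> space S. R (f \<omega>) p}) \<in> borel_measurable L"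
    if "f \<in> borel_measurable L" for f and L :: "'q measure"
    by (rule measurable_compose[OF that Q_meas])
  have sec: "emeasure (distr N ?B Z) (Pair ys -` T) = ennreal (\<Prod>i<m. measure Q {p \<in> space S. R (ys i) p})" for ys
  proof -
    define V where "V = {zs \<in> space ?B. \<forall>i<m. R (ys i) (zs i)}"
    have [measurable]: "V \<in> sets ?B" unfolding V_def by measurable
    have "Pair ys -` T = V"
      by (auto simp: V_def T_def space_pair_measure space_PiM)
    then have "emeasure (distr N ?B Z) (Pair ys -` T) = emeasure (distr N ?B Z) V"
      by (rule arg_cong)
    also have "\<dots> = emeasure N (Z -` V \<inter> space N)"
      by (rule emeasure_distr) measurable
    also have "Z -` V \<inter> space N = {\<omega> \<in> space N. \<forall>i<m. R (ys i) (\<Xi> i \<omega>)}"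
      using measurable_space[OF Z_meas] by (auto simp: V_def) (simp_all add: Z_def)
    also have "emeasure N {\<omega> \<in> space N. \<forall>i<m. R (ys i) (\<Xi> i \<omega>)} = ennreal (\<Prod>i<m. measure Q {p \<in> space S. R (ys i) p})"
    proof (cases "m = 0")
      case True
      then show ?thesis by (simp add: emeasure_space_1)
    next
      case False
      have "{\<omega> \<in> space N. \<forall>i<m. R (ys i) (\<Xi> i \<omega>)} = (\<Inter>i\<in>{..<m}. \<Xi> i -` {p \<in> space S. R (ys i) p} \<inter> space N)"
        using False measurable_space[OF \<Xi>] by auto
      also have "prob \<dots> = (\<Prod>i<m. prob (\<Xi> i -` {p \<in> space S. R (ys i) p} \<inter> space N))"
        using False by (intro indep_varsD[OF ind]) auto
      also have "\<dots> = (\<Prod>i<m. measure Q {p \<in> space S. R (ys i) p})"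
      proof (rule prod.cong[OF refl])
        fix i
        have "measure (distr N S (\<Xi> i)) {p \<in> space S. R (ys i) p} = prob (\<Xi> i -` {p \<in> space S. R (ys i) p} \<inter> space N)"
          by (rule measure_distr) measurable
        then show "prob (\<Xi> i -` {p \<in> space S. R (ys i) p} \<inter> space N) = measure Q {p \<in> space S. R (ys i) p}"
          by (simp only: law)
      qed
      finally show ?thesis by (simp add: emeasure_eq_measure)
    qed
    finally show ?thesis .
  qed
  have prod_nonneg: "0 \<le> (\<Prod>i<m. measure Q {p \<in> space S. R (ys i) p})" for ys
    by (intro prod_nonneg) auto
  have "emeasure N {\<omega> \<in> space N. \<forall>i<m. R (y i \<omega>) (\<Xi> i \<omega>)}
      = emeasure (distr N (?A \<Otimes>\<^sub>M ?B) (\<lambda>\<omega>. (Y \<omega>, Z \<omega>))) T"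
  proof (subst emeasure_distr)
    have "(\<lambda>\<omega>. (Y \<omega>, Z \<omega>)) -` T \<inter> space N = {\<omega> \<in> space N. \<forall>i<m. R (y i \<omega>) (\<Xi> i \<omega>)}"
      using measurable_space[OF Z_meas] measurable_space[OF Y_meas]
      by (auto simp: T_def space_pair_measure) (simp_all add: Y_def Z_def)
    then show "emeasure N {\<omega> \<in> space N. \<forall>i<m. R (y i \<omega>) (\<Xi> i \<omega>)} = emeasure N ((\<lambda>\<omega>. (Y \<omega>, Z \<omega>)) -` T \<inter> space N)"
      by simp
  qed measurable
  also have "distr N (?A \<Otimes>\<^sub>M ?B) (\<lambda>\<omega>. (Y \<omega>, Z \<omega>)) = distr N ?A Y \<Otimes>\<^sub>M distr N ?B Z"
    by (rule distr_pair_of_indep_vimage_algebras[OF Y_meas Z_meas])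
      (use indep in \<open>simp add: Y_def[abs_def] Z_def[abs_def]\<close>)
  also have "emeasure (distr N ?A Y \<Otimes>\<^sub>M distr N ?B Z) T = (\<integral>\<^sup>+ys. emeasure (distr N ?B Z) (Pair ys -` T) \<partial>distr N ?A Y)"
    by (rule Z.emeasure_pair_measure_alt) (simp cong: sets_pair_measure_cong)
  also have "\<dots> = (\<integral>\<^sup>+\<omega>. ennreal (\<Prod>i<m. measure Q {p \<in> space S. R (y i \<omega>) p}) \<partial>N)"
    unfolding sec by (subst nn_integral_distr) (simp_all add: Y_def)
  also have "\<dots> = ennreal (LINT \<omega>|N. (\<Prod>i<m. measure Q {p \<in> space S. R (y i \<omega>) p}))"
  proof (rule nn_integral_eq_integral)
    show "integrable N (\<lambda>\<omega>. \<Prod>i<m. measure Q {p \<in> space S. R (y i \<omega>) p})"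
      by (rule integrable_const_bound[where B=1])
        (auto intro!: AE_I2 prod_le_1 simp: abs_prod)
  qed (simp add: prod_nonneg)
  finally show ?thesis
    by (simp add: emeasure_eq_measure integral_nonneg_AE prod_nonneg)
qed

lemma nn_integral_brown_resnick_intensity:
  assumes [measurable]: "f \<in> borel_measurable borel"
  shows "(\<integral>\<^sup>+r. f r \<partial>brown_resnick_intensity) = (\<integral>\<^sup>+r. ennreal (1 / r\<^sup>2) * f r * indicator {0<..} r \<partial>lborel)"
proof -
  have m: "h \<in> borel_measurable (restrict_space lborel {0<..})" if "h \<in> borel_measurable borel" for h :: "real \<Rightarrow> 'b :: topological_space"
    using that by (auto intro!: measurable_restrict_space1)
  show ?thesis
    unfolding brown_resnick_intensity_def
    by (subst nn_integral_density) (auto intro!: m simp: nn_integral_restrict_space)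
qed

lemma brown_resnick_intensity_tail:
  assumes z: "0 < (z::real)"
  shows "(\<integral>\<^sup>+r. ennreal (1 / r\<^sup>2) * indicator {r. 1 < r * z} r * indicator {0<..} r \<partial>lborel) = ennreal z"
proof -
  have "(\<integral>\<^sup>+r. ennreal (1 / r\<^sup>2) * indicator {r. 1 < r * z} r * indicator {0<..} r \<partial>lborel)
      = (\<integral>\<^sup>+r. ennreal (1 / r\<^sup>2) * indicator {1 / z ..} r \<partial>lborel)"
  proof (rule nn_integral_cong_AE)
    show "AE r in lborel. ennreal (1 / r\<^sup>2) * indicator {r. 1 < r * z} r * indicator {0<..} r
        = ennreal (1 / r\<^sup>2) * indicator {1 / z ..} r"
      using AE_lborel_singleton[of "1 / z"]
    proof eventually_elim
      case (elim r)
      have "1 < r * z \<longleftrightarrow> 1 / z < r" using z by (simp add: field_simps)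
      moreover have "0 < r" if "1 / z < r" using z that by (meson less_trans zero_less_divide_1_iff)
      ultimately show ?case using elim by (auto simp: indicator_def)
    qed
  qed
  also have "\<dots> = ennreal (0 - (- (1 / (1 / z))))"
  proof (rule nn_integral_FTC_atLeast)
    show "((\<lambda>r. - (1 / r)) has_real_derivative 1 / r\<^sup>2) (at r)" if "1 / z \<le> r" for r
    proof -
      have "0 < r" using z that by (meson less_le_trans zero_less_divide_1_iff)
      then show ?thesis
        by (auto intro!: derivative_eq_intros simp: power2_eq_square)
    qed
    show "((\<lambda>r::real. - (1 / r)) \<longlongrightarrow> 0) at_top"
      using tendsto_minus[OF tendsto_inverse_0_at_top[OF filterlim_ident]] by (simp add: inverse_eq_divide)
  qed auto
  finally show ?thesis by simp
qed

text \<open>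
  By Fubini, \<open>\<integral> Q (r Z > 1) r\<^sup>-\<^sup>2 dr\<close> is the \<open>Q\<close>-expectation of the tail integral, which is \<open>Z\<close>.
\<close>

lemma brown_resnick_intensity_integral_tail:
  fixes Z :: "'p \<Rightarrow> real"
  assumes "prob_space Q" and Z: "\<And>p. 0 < Z p" "integrable Q Z"
    and g: "\<And>r. 0 < r \<Longrightarrow> g r = measure Q {p \<in> space Q. 1 < r * Z p}"
    and g_meas [measurable]: "g \<in> borel_measurable borel"
  shows "integrable brown_resnick_intensity g" "(LINT r|brown_resnick_intensity. g r) = (LINT p|Q. Z p)"
proof -
  interpret Q: prob_space Q by fact
  interpret pair_sigma_finite lborel Q by unfold_locales
  have [measurable]: "Z \<in> borel_measurable Q" using Z(2) by simp
  have "(\<integral>\<^sup>+r. ennreal (g r) \<partial>brown_resnick_intensity)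
      = (\<integral>\<^sup>+r. ennreal (1 / r\<^sup>2) * ennreal (g r) * indicator {0<..} r \<partial>lborel)"
    by (rule nn_integral_brown_resnick_intensity) simp
  also have "\<dots> = (\<integral>\<^sup>+r. (\<integral>\<^sup>+p. ennreal (1 / r\<^sup>2) * indicator {r. 1 < r * Z p} r * indicator {0<..} r \<partial>Q) \<partial>lborel)"
  proof (rule nn_integral_cong)
    fix r :: real
    have "(\<integral>\<^sup>+p. ennreal (1 / r\<^sup>2) * indicator {r. 1 < r * Z p} r * indicator {0<..} r \<partial>Q)
        = (\<integral>\<^sup>+p. (ennreal (1 / r\<^sup>2) * indicator {0<..} r) * indicator {p \<in> space Q. 1 < r * Z p} p \<partial>Q)"
      by (rule nn_integral_cong) (auto simp: indicator_def)
    also have "\<dots> = ennreal (1 / r\<^sup>2) * indicator {0<..} r * emeasure Q {p \<in> space Q. 1 < r * Z p}"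
      by (rule nn_integral_cmult_indicator) simp
    also have "\<dots> = ennreal (1 / r\<^sup>2) * ennreal (g r) * indicator {0<..} r"
      by (auto simp: indicator_def g Q.emeasure_eq_measure)
    finally show "ennreal (1 / r\<^sup>2) * ennreal (g r) * indicator {0<..} r
      = (\<integral>\<^sup>+p. ennreal (1 / r\<^sup>2) * indicator {r. 1 < r * Z p} r * indicator {0<..} r \<partial>Q)" by simp
  qed
  also have "\<dots> = (\<integral>\<^sup>+p. (\<integral>\<^sup>+r. ennreal (1 / r\<^sup>2) * indicator {r. 1 < r * Z p} r * indicator {0<..} r \<partial>lborel) \<partial>Q)"
    by (rule Fubini'[symmetric]) (simp add: indicator_def)
  also have "\<dots> = (\<integral>\<^sup>+p. ennreal (Z p) \<partial>Q)"
    by (simp add: brown_resnick_intensity_tail Z(1))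
  also have "\<dots> = ennreal (LINT p|Q. Z p)"
    using Z by (intro nn_integral_eq_integral) (auto intro: less_imp_le)
  finally have nn: "(\<integral>\<^sup>+r. ennreal (g r) \<partial>brown_resnick_intensity) = ennreal (LINT p|Q. Z p)" .
  have [measurable]: "g \<in> borel_measurable brown_resnick_intensity"
    unfolding brown_resnick_intensity_def by (auto intro!: measurable_restrict_space1)
  have sp: "AE r in brown_resnick_intensity. 0 \<le> g r"
    by (rule AE_I2) (simp add: brown_resnick_intensity_def g)
  show "integrable brown_resnick_intensity g"
    using nn sp by (intro integrableI_nn_integral_finite) auto
  show "(LINT r|brown_resnick_intensity. g r) = (LINT p|Q. Z p)"
    using sp by (subst integral_eq_nn_integral)
      (auto simp: nn intro!: enn2real_ennreal integral_nonneg_AE AE_I2 less_imp_le[OF Z(1)])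
qed

section \<open>The law of the Brown-Resnick process\<close>

lemma borel_measurable_vec_nth [measurable (raw)]:
  fixes f :: "'a \<Rightarrow> real ^ 'd"
  assumes "f \<in> borel_measurable M"
  shows "(\<lambda>x. f x $ k) \<in> borel_measurable M"
  using borel_measurable_inner[OF assms borel_measurable_const[of "axis k 1"]]
  by (simp add: inner_axis)

lemma borel_measurable_vec_lambda:
  fixes f :: "'d::finite \<Rightarrow> 'a \<Rightarrow> real"
  assumes "\<And>k. f k \<in> borel_measurable M"
  shows "(\<lambda>x. \<chi> k. f k x) \<in> borel_measurable M"
  by (rule borel_measurable_euclidean_space[THEN iffD2])
    (use assms in \<open>auto simp: Basis_vec_def inner_axis\<close>)

text \<open>
  An unbounded set has no upper bounds, so its \<open>Sup\<close> is one and the same unspecified number. This is what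
  makes pointwise suprema measurable even where they are infinite.
\<close>

lemma Sup_unbounded_real:
  fixes A :: "real set"
  assumes "\<not> bdd_above A"
  shows "Sup A = (LEAST z. False)"
proof -
  have "(\<forall>x\<in>A. x \<le> z) = False" for z
    using assms by (auto simp: bdd_above_def)
  then show ?thesis by (simp only: Sup_real_def)
qed

lemma borel_measurable_SUP_real:
  fixes f :: "nat \<Rightarrow> 'a \<Rightarrow> real"
  assumes [measurable]: "\<And>i. f i \<in> borel_measurable M"
  shows "(\<lambda>x. SUP i. f i x) \<in> borel_measurable M"
proof -
  define G where "G = {x \<in> space M. \<exists>n::nat. \<forall>i. f i x \<le> real n}"
  have [measurable]: "G \<in> sets M" unfolding G_def by measurable
  have bdd: "bdd_above (range (\<lambda>i. f i x)) \<longleftrightarrow> x \<in> G" if "x \<in> space M" for x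
  proof
    assume "bdd_above (range (\<lambda>i. f i x))"
    then obtain c where c: "\<And>i. f i x \<le> c" by (auto simp: bdd_above_def)
    obtain n :: nat where "c \<le> real n" using real_arch_simple by blast
    then show "x \<in> G" using that c by (auto simp: G_def intro: order_trans)
  qed (auto simp: G_def bdd_above_def)
  have "(\<lambda>x. if x \<in> G then SUP i. (if x \<in> G then f i x else 0) else (LEAST z. False)) \<in> borel_measurable M"
  proof (rule measurable_If_set)
    show "(\<lambda>x. SUP i. (if x \<in> G then f i x else 0)) \<in> borel_measurable M"
    proof (rule borel_measurable_cSUP)
      show "bdd_above ((\<lambda>i. if x \<in> G then f i x else 0) ` UNIV)" if "x \<in> space M" for x
        using bdd[OF that] by (cases "x \<in> G") auto
    qed simp_all
  qed simp_all
  then show ?thesis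
    by (rule measurable_cong[THEN iffD1, rotated]) (auto simp: bdd Sup_unbounded_real)
qed

locale brown_resnick_representation =
  fixes M :: "'a measure" and \<xi> :: "real \<Rightarrow> 'a \<Rightarrow> real ^ 'd"
    and N :: "'w measure" and y :: "nat \<Rightarrow> 'w \<Rightarrow> real"
    and \<Xi> :: "nat \<Rightarrow> real \<Rightarrow> 'w \<Rightarrow> real ^ 'd"
  assumes prob_space_M: "prob_space M"
    and \<xi>_measurable [measurable]: "\<And>t. \<xi> t \<in> borel_measurable M"
    and integrable_exp: "\<And>t k. integrable M (\<lambda>\<omega>. exp (\<xi> t \<omega> $ k))"
    and data: "brown_resnick_data M \<xi> N y \<Xi>"
begin

sublocale N: prob_space N
  using data by (simp add: brown_resnick_data_def poisson_point_process_def)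

sublocale M: prob_space M
  by (rule prob_space_M)

lemma ppp: "poisson_point_process N brown_resnick_intensity y"
  using data by (simp add: brown_resnick_data_def)

lemma y_measurable [measurable]: "y i \<in> borel_measurable N"
proof -
  have "y i \<in> measurable N brown_resnick_intensity"
    using ppp by (simp add: poisson_point_process_def)
  then have "y i \<in> measurable N (restrict_space lborel {0<..})"
    by (simp add: brown_resnick_intensity_def measurable_cong_sets[OF refl sets_density])
  then show ?thesis
    by (simp add: measurable_restrict_space2_iff)
qed

lemma y_pos: "\<omega> \<in> space N \<Longrightarrow> 0 < y i \<omega>"
proof -
  assume "\<omega> \<in> space N"
  moreover have "y i \<in> measurable N brown_resnick_intensity"
    using ppp by (simp add: poisson_point_process_def)
  ultimately have "y i \<omega> \<in> space brown_resnick_intensity" by (rule measurable_space[rotated])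
  then show "0 < y i \<omega>" by (simp add: brown_resnick_intensity_def space_restrict_space)
qed

lemma \<Xi>_path_measurable [measurable]: "(\<lambda>\<omega> t. \<Xi> i t \<omega>) \<in> measurable N path_algebra"
  using data by (simp add: brown_resnick_data_def N.indep_vars_def)

lemma \<Xi>_measurable [measurable]: "\<Xi> i t \<in> borel_measurable N"
  using measurable_compose[OF \<Xi>_path_measurable measurable_component_singleton[of t]] by simp

lemma \<xi>_path_measurable [measurable]: "(\<lambda>\<omega> t. \<xi> t \<omega>) \<in> measurable M path_algebra"
  by (rule measurable_abs_UNIV) simp

text \<open>
  The distribution function of \<open>\<eta>\<close>, before suprema are taken. The event is the decreasing limit of the
  events that concern the first \<open>m\<close> points only.
\<close>

lemma prob_terms_le:
  fixes \<tau> :: "'i \<Rightarrow> real" and \<kappa> :: "'i \<Rightarrow> 'd"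
  assumes I: "finite I" "I \<noteq> {}" and x: "\<And>a. a \<in> I \<Longrightarrow> 0 < x a"
  shows "N.prob {\<omega> \<in> space N. \<forall>i. \<forall>a\<in>I. y i \<omega> * exp (\<Xi> i (\<tau> a) \<omega> $ \<kappa> a) \<le> x a}
    = exp (- (LINT \<omega>|M. Max ((\<lambda>a. (1 / x a) * exp (\<xi> (\<tau> a) \<omega> $ \<kappa> a)) ` I)))"
proof -
  \<comment> \<open>a point at height \<open>r\<close> with path \<open>p\<close> respects all bounds; for \<open>r > 0\<close> this is \<open>r * Z p \<le> 1\<close>\<close>
  define R where "R r p \<longleftrightarrow> (\<forall>a\<in>I. r * exp (p (\<tau> a) $ \<kappa> a) \<le> x a)" for r :: real and p :: "real \<Rightarrow> real ^ 'd"
  define Z where "Z p = Max ((\<lambda>a. (1 / x a) * exp (p (\<tau> a) $ \<kappa> a)) ` I)" for p :: "real \<Rightarrow> real ^ 'd"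
  define Q where "Q = distr M path_algebra (\<lambda>\<omega> t. \<xi> t \<omega>)"
  interpret Q: prob_space Q unfolding Q_def by (rule M.prob_space_distr) simp
  have spaceQ: "space Q = UNIV" by (simp add: Q_def space_PiM)
  have setsQ [measurable_cong]: "sets Q = sets path_algebra" by (simp add: Q_def)
  have R_meas: "Measurable.pred (borel \<Otimes>\<^sub>M path_algebra) (\<lambda>q. R (fst q) (snd q))"
    unfolding R_def using I(1) by measurable
  have Z_meas [measurable]: "Z \<in> borel_measurable path_algebra"
    unfolding Z_def using I(1) by measurable
  have Z_int: "integrable M (\<lambda>\<omega>. Z (\<lambda>t. \<xi> t \<omega>))"
    unfolding Z_def using I x by (intro integrable_Max_scaled_exp integrable_exp) auto
  have Z_pos: "0 < Z p" for p
    unfolding Z_def using I x by (subst Max_gr_iff) auto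
  have R_iff: "R r p \<longleftrightarrow> r * Z p \<le> 1" if "0 < r" for r p
  proof -
    have "r * Z p \<le> 1 \<longleftrightarrow> Z p \<le> 1 / r" using that by (simp add: field_simps)
    also have "\<dots> \<longleftrightarrow> (\<forall>a\<in>I. (1 / x a) * exp (p (\<tau> a) $ \<kappa> a) \<le> 1 / r)"
      unfolding Z_def using I by (subst Max_le_iff) auto
    also have "\<dots> \<longleftrightarrow> R r p"
      unfolding R_def using that x by (intro ball_cong) (auto simp: field_simps)
    finally show ?thesis by simp
  qed
  define g where "g r = 1 - measure Q {p \<in> space path_algebra. R r p}" for r
  have R_sec [measurable]: "Measurable.pred path_algebra (R r)" for r
    unfolding R_def using I(1) by measurable
  have g_eq: "g r = measure Q {p \<in> space Q. 1 < r * Z p}" if "0 < r" for r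
  proof -
    have "{p \<in> space Q. 1 < r * Z p} = space Q - {p \<in> space path_algebra. R r p}"
      using that by (auto simp: R_iff spaceQ space_PiM not_le)
    moreover have "{p \<in> space path_algebra. R r p} \<in> sets Q"
      unfolding setsQ by measurable
    ultimately show ?thesis by (simp add: g_def Q.prob_compl)
  qed
  have g_meas [measurable]: "g \<in> borel_measurable borel"
  proof -
    have "{q \<in> space (borel \<Otimes>\<^sub>M path_algebra). R (fst q) (snd q)} \<in> sets (borel \<Otimes>\<^sub>M Q)"
      using R_meas unfolding pred_def by (simp cong: sets_pair_measure_cong add: setsQ)
    from Q.measurable_emeasure_Pair[OF this]
    have "(\<lambda>r. emeasure Q {p \<in> space path_algebra. R r p}) \<in> borel_measurable borel"
      by (rule measurable_cong[THEN iffD1, rotated])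
        (auto intro!: arg_cong2[where f=emeasure] simp: space_pair_measure space_PiM)
    then show ?thesis unfolding g_def measure_def by measurable
  qed
  have Z_intQ: "integrable Q Z"
    unfolding Q_def using Z_int by (subst integrable_distr_eq) simp_all
  note g_int = brown_resnick_intensity_integral_tail[OF Q.prob_space_axioms Z_pos Z_intQ g_eq g_meas]
  have ZQ: "(LINT p|Q. Z p) = (LINT \<omega>|M. Z (\<lambda>t. \<xi> t \<omega>))"
    unfolding Q_def by (rule integral_distr) simp_all
  have "N.prob {\<omega> \<in> space N. \<forall>i<m. R (y i \<omega>) (\<lambda>t. \<Xi> i t \<omega>)} = (LINT \<omega>|N. (\<Prod>i<m. (1 - g (y i \<omega>))))" for m
    unfolding g_def
    by (subst prob_marks_of_points[where S=path_algebra and Q=Q and \<Xi>="\<lambda>i \<omega> t. \<Xi> i t \<omega>" and R=R])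
      (use data R_meas in \<open>auto simp: brown_resnick_data_def Q_def N.prob_space_axioms\<close>)
  moreover have "(\<lambda>m. LINT \<omega>|N. (\<Prod>i<m. (1 - g (y i \<omega>)))) \<longlonglongrightarrow> exp (- (LINT r|brown_resnick_intensity. g r))"
  proof (rule poisson_generating_functional[OF ppp])
    show "0 \<le> g r" "g r \<le> 1" for r by (simp_all add: g_def)
  qed (rule g_int(1))
  ultimately have lim: "(\<lambda>m. N.prob {\<omega> \<in> space N. \<forall>i<m. R (y i \<omega>) (\<lambda>t. \<Xi> i t \<omega>)}) \<longlonglongrightarrow> exp (- (LINT \<omega>|M. Z (\<lambda>t. \<xi> t \<omega>)))"
    by (simp add: g_int(2) ZQ)
  have [measurable]: "Measurable.pred N (\<lambda>\<omega>. R (y i \<omega>) (\<lambda>t. \<Xi> i t \<omega>))" for i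
    unfolding R_def using I(1) by measurable
  have "(\<lambda>m. N.prob {\<omega> \<in> space N. \<forall>i<m. R (y i \<omega>) (\<lambda>t. \<Xi> i t \<omega>)}) \<longlonglongrightarrow>
      N.prob (\<Inter>m. {\<omega> \<in> space N. \<forall>i<m. R (y i \<omega>) (\<lambda>t. \<Xi> i t \<omega>)})"
  proof (rule N.finite_Lim_measure_decseq)
    have "{\<omega> \<in> space N. \<forall>i<m. R (y i \<omega>) (\<lambda>t. \<Xi> i t \<omega>)} \<in> sets N" for m by measurable
    then show "range (\<lambda>m. {\<omega> \<in> space N. \<forall>i<m. R (y i \<omega>) (\<lambda>t. \<Xi> i t \<omega>)}) \<subseteq> sets N" by auto
    show "decseq (\<lambda>m. {\<omega> \<in> space N. \<forall>i<m. R (y i \<omega>) (\<lambda>t. \<Xi> i t \<omega>)})"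
      by (auto simp: decseq_def)
  qed
  moreover have "(\<Inter>m. {\<omega> \<in> space N. \<forall>i<m. R (y i \<omega>) (\<lambda>t. \<Xi> i t \<omega>)}) = {\<omega> \<in> space N. \<forall>i. R (y i \<omega>) (\<lambda>t. \<Xi> i t \<omega>)}"
    by auto
  ultimately show ?thesis
    using LIMSEQ_unique[OF _ lim] by (simp add: R_def Z_def)
qed

text \<open>
  The probability that all terms are below \<open>n + 1\<close> is \<open>exp (- c / (n + 1))\<close>, which tends to \<open>1\<close>.
\<close>

lemma AE_terms_bounded:
  "AE \<omega> in N. bdd_above (range (\<lambda>i. y i \<omega> * exp (\<Xi> i t \<omega> $ k)))"
proof -
  define B where "B n = {\<omega> \<in> space N. \<forall>i. y i \<omega> * exp (\<Xi> i t \<omega> $ k) \<le> real (Suc n)}" for n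
  have B_meas [measurable]: "B n \<in> sets N" for n unfolding B_def by measurable
  define c where "c = (LINT \<omega>|M. exp (\<xi> t \<omega> $ k))"
  have "N.prob (B n) = exp (- (c / real (Suc n)))" for n
    using prob_terms_le[of "{()}" "\<lambda>_. real (Suc n)" "\<lambda>_. t" "\<lambda>_. k"] by (simp add: B_def c_def)
  moreover have "(\<lambda>n. exp (- (c / real (Suc n)))) \<longlonglongrightarrow> exp (- 0)"
    by (intro tendsto_intros LIMSEQ_Suc[OF lim_const_over_n])
  ultimately have "(\<lambda>n. N.prob (B n)) \<longlonglongrightarrow> 1" by simp
  moreover have "(\<lambda>n. N.prob (B n)) \<longlonglongrightarrow> N.prob (\<Union>n. B n)"
    by (rule N.finite_Lim_measure_incseq) (auto simp: B_def incseq_def intro: order_trans)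
  ultimately have "N.prob (\<Union>n. B n) = 1" by (intro LIMSEQ_unique)
  then have "AE \<omega> in N. \<omega> \<in> (\<Union>n. B n)" by (subst N.prob_eq_1[symmetric]) auto
  then show ?thesis
    by eventually_elim (auto simp: B_def bdd_above_def)
qed

abbreviation "\<eta> \<equiv> brown_resnick_process y \<Xi>"

lemma \<eta>_measurable [measurable]: "\<eta> t \<in> borel_measurable N"
  unfolding brown_resnick_process_def[abs_def]
  by (intro borel_measurable_vec_lambda borel_measurable_SUP_real) measurable

text \<open>
  Where the terms are bounded, \<open>\<eta> \<le> x\<close> means that all terms are at most \<open>x\<close>. Terms are positive, so the
  event is empty as soon as one bound is not.
\<close>

lemma prob_process_le:
  fixes \<tau> :: "'i \<Rightarrow> real" and \<kappa> :: "'i \<Rightarrow> 'd"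
  assumes I: "finite I" "I \<noteq> {}"
  shows "N.prob {\<omega> \<in> space N. \<forall>a\<in>I. \<eta> (\<tau> a) \<omega> $ \<kappa> a \<le> x a}
    = (if \<forall>a\<in>I. 0 < x a
       then exp (- (LINT \<omega>|M. Max ((\<lambda>a. (1 / x a) * exp (\<xi> (\<tau> a) \<omega> $ \<kappa> a)) ` I))) else 0)"
proof -
  have bdd: "AE \<omega> in N. \<forall>a\<in>I. bdd_above (range (\<lambda>i. y i \<omega> * exp (\<Xi> i (\<tau> a) \<omega> $ \<kappa> a)))"
    using I(1) AE_terms_bounded by (simp add: AE_finite_all)
  have [measurable]: "{\<omega> \<in> space N. \<forall>a\<in>I. \<eta> (\<tau> a) \<omega> $ \<kappa> a \<le> x a} \<in> sets N"
    "{\<omega> \<in> space N. \<forall>i. \<forall>a\<in>I. y i \<omega> * exp (\<Xi> i (\<tau> a) \<omega> $ \<kappa> a) \<le> x a} \<in> sets N"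
    using I(1) by measurable
  have "N.prob {\<omega> \<in> space N. \<forall>a\<in>I. \<eta> (\<tau> a) \<omega> $ \<kappa> a \<le> x a}
      = N.prob {\<omega> \<in> space N. \<forall>i. \<forall>a\<in>I. y i \<omega> * exp (\<Xi> i (\<tau> a) \<omega> $ \<kappa> a) \<le> x a}"
  proof (rule N.finite_measure_eq_AE)
    show "AE \<omega> in N. \<omega> \<in> {\<omega> \<in> space N. \<forall>a\<in>I. \<eta> (\<tau> a) \<omega> $ \<kappa> a \<le> x a}
      \<longleftrightarrow> \<omega> \<in> {\<omega> \<in> space N. \<forall>i. \<forall>a\<in>I. y i \<omega> * exp (\<Xi> i (\<tau> a) \<omega> $ \<kappa> a) \<le> x a}"
      using bdd by eventually_elim (auto simp: brown_resnick_process_def cSUP_le_iff)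
  qed measurable
  also have "\<dots> = (if \<forall>a\<in>I. 0 < x a
       then exp (- (LINT \<omega>|M. Max ((\<lambda>a. (1 / x a) * exp (\<xi> (\<tau> a) \<omega> $ \<kappa> a)) ` I))) else 0)"
  proof (cases "\<forall>a\<in>I. 0 < x a")
    case True
    then show ?thesis using prob_terms_le[OF I, of x \<tau> \<kappa>] by simp
  next
    case False
    then obtain a where a: "a \<in> I" "x a \<le> 0" by (auto simp: not_less)
    have "\<not> y 0 \<omega> * exp (\<Xi> 0 (\<tau> a) \<omega> $ \<kappa> a) \<le> x a" if "\<omega> \<in> space N" for \<omega>
      using a(2) mult_pos_pos[OF y_pos[OF that, of 0] exp_gt_zero, of "\<Xi> 0 (\<tau> a) \<omega> $ \<kappa> a"] by linarith
    then have empty: "{\<omega> \<in> space N. \<forall>i. \<forall>a\<in>I. y i \<omega> * exp (\<Xi> i (\<tau> a) \<omega> $ \<kappa> a) \<le> x a} = {}"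
      using a(1) by blast
    show ?thesis unfolding empty if_not_P[OF False] by simp
  qed
  finally show ?thesis .
qed

definition max_moments_stationary :: bool where
  "max_moments_stationary \<longleftrightarrow> (\<forall>(n::nat) (t :: nat \<Rightarrow> real) (s::real) (c :: nat \<times> 'd \<Rightarrow> real).
     n \<ge> 1 \<longrightarrow> (\<forall>a\<in>{..<n} \<times> UNIV. 0 < c a) \<longrightarrow>
     (LINT \<omega>|M. Max ((\<lambda>a. c a * exp (\<xi> (t (fst a) + s) \<omega> $ snd a)) ` ({..<n} \<times> UNIV)))
     = (LINT \<omega>|M. Max ((\<lambda>a. c a * exp (\<xi> (t (fst a)) \<omega> $ snd a)) ` ({..<n} \<times> UNIV))))"

text \<open>
  Up to the substitution \<open>c = 1 / x\<close>, the max moments are the negative logarithms of the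
  finite-dimensional distribution functions. The finite-dimensional laws of the vector-valued process are
  images of the laws of its family of coordinates under the map \<open>\<Phi>\<close> that groups coordinates into vectors.
\<close>

lemma strictly_stationary_iff_max_moments:
  "strictly_stationary N \<eta> \<longleftrightarrow> max_moments_stationary"
proof
  assume st: "strictly_stationary N \<eta>"
  show max_moments_stationary
    unfolding max_moments_stationary_def
  proof (intro allI impI)
    fix n :: nat and t :: "nat \<Rightarrow> real" and s :: real and c :: "nat \<times> 'd \<Rightarrow> real"
    assume n: "n \<ge> 1" and c: "\<forall>a\<in>{..<n} \<times> UNIV. 0 < c a"
    define I :: "(nat \<times> 'd) set" where "I = {..<n} \<times> UNIV"
    have I: "finite I" "I \<noteq> {}" using n by (auto simp: I_def lessThan_empty_iff)
    define V where "V = {z \<in> space (\<Pi>\<^sub>M i\<in>{..<n}. (borel :: (real ^ 'd) measure)). \<forall>a\<in>I. z (fst a) $ snd a \<le> 1 / c a}"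
    have V [measurable]: "V \<in> sets (\<Pi>\<^sub>M i\<in>{..<n}. (borel :: (real ^ 'd) measure))"
    proof -
      have [measurable]: "(\<lambda>z. z (fst a) $ snd a) \<in> borel_measurable (\<Pi>\<^sub>M i\<in>{..<n}. (borel :: (real ^ 'd) measure))"
        if "a \<in> I" for a
        using that by (intro borel_measurable_vec_nth measurable_component_singleton) (auto simp: I_def)
      show ?thesis unfolding V_def using I(1) by measurable
    qed
    have pull: "measure (distr N (\<Pi>\<^sub>M i\<in>{..<n}. borel) (\<lambda>\<omega>. \<lambda>i\<in>{..<n}. \<eta> (r i) \<omega>)) V
        = exp (- (LINT \<omega>|M. Max ((\<lambda>a. c a * exp (\<xi> (r (fst a)) \<omega> $ snd a)) ` I)))" for r :: "nat \<Rightarrow> real"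
    proof -
      have "measure (distr N (\<Pi>\<^sub>M i\<in>{..<n}. borel) (\<lambda>\<omega>. \<lambda>i\<in>{..<n}. \<eta> (r i) \<omega>)) V
          = N.prob ((\<lambda>\<omega>. \<lambda>i\<in>{..<n}. \<eta> (r i) \<omega>) -` V \<inter> space N)"
        by (rule measure_distr) measurable
      also have "(\<lambda>\<omega>. \<lambda>i\<in>{..<n}. \<eta> (r i) \<omega>) -` V \<inter> space N = {\<omega> \<in> space N. \<forall>a\<in>I. \<eta> (r (fst a)) \<omega> $ snd a \<le> 1 / c a}"
        by (auto simp: V_def space_PiM I_def)
      also have "N.prob \<dots> = exp (- (LINT \<omega>|M. Max ((\<lambda>a. c a * exp (\<xi> (r (fst a)) \<omega> $ snd a)) ` I)))"
        using prob_process_le[OF I, of "\<lambda>a. r (fst a)" snd "\<lambda>a. 1 / c a"] c by (simp add: I_def)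
      finally show ?thesis .
    qed
    have "distr N (\<Pi>\<^sub>M i\<in>{..<n}. borel) (\<lambda>\<omega>. \<lambda>i\<in>{..<n}. \<eta> (t i + s) \<omega>)
        = distr N (\<Pi>\<^sub>M i\<in>{..<n}. borel) (\<lambda>\<omega>. \<lambda>i\<in>{..<n}. \<eta> (t i) \<omega>)"
      using st by (simp add: strictly_stationary_def)
    then show "(LINT \<omega>|M. Max ((\<lambda>a. c a * exp (\<xi> (t (fst a) + s) \<omega> $ snd a)) ` ({..<n} \<times> UNIV)))
     = (LINT \<omega>|M. Max ((\<lambda>a. c a * exp (\<xi> (t (fst a)) \<omega> $ snd a)) ` ({..<n} \<times> UNIV)))"
      using pull[of "\<lambda>i. t i + s"] pull[of t] by (simp add: I_def)
  qed
next
  assume mm: max_moments_stationary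
  show "strictly_stationary N \<eta>"
    unfolding strictly_stationary_def
  proof (intro conjI allI)
    fix n :: nat and t :: "nat \<Rightarrow> real" and s :: real
    define I :: "(nat \<times> 'd) set" where "I = {..<n} \<times> UNIV"
    have I: "finite I" by (auto simp: I_def)
    define \<Phi> :: "(nat \<times> 'd \<Rightarrow> real) \<Rightarrow> nat \<Rightarrow> real ^ 'd" where "\<Phi> z = (\<lambda>i\<in>{..<n}. \<chi> k. z (i, k))" for z
    have \<Phi> [measurable]: "\<Phi> \<in> measurable (\<Pi>\<^sub>M a\<in>I. borel) (\<Pi>\<^sub>M i\<in>{..<n}. borel)"
      unfolding \<Phi>_def
      by (intro measurable_restrict borel_measurable_vec_lambda measurable_component_singleton) (auto simp: I_def)
    have push: "distr N (\<Pi>\<^sub>M i\<in>{..<n}. borel) (\<lambda>\<omega>. \<lambda>i\<in>{..<n}. \<eta> (r i) \<omega>)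
        = distr (distr N (\<Pi>\<^sub>M a\<in>I. borel) (\<lambda>\<omega>. \<lambda>a\<in>I. \<eta> (r (fst a)) \<omega> $ snd a)) (\<Pi>\<^sub>M i\<in>{..<n}. borel) \<Phi>" for r :: "nat \<Rightarrow> real"
    proof -
      have "\<Phi> (\<lambda>a\<in>I. \<eta> (r (fst a)) \<omega> $ snd a) = (\<lambda>i\<in>{..<n}. \<eta> (r i) \<omega>)" for \<omega>
        by (auto simp: \<Phi>_def I_def fun_eq_iff vec_eq_iff)
      then show ?thesis by (simp add: distr_distr comp_def)
    qed
    have "distr N (\<Pi>\<^sub>M a\<in>I. borel) (\<lambda>\<omega>. \<lambda>a\<in>I. \<eta> (t (fst a) + s) \<omega> $ snd a)
        = distr N (\<Pi>\<^sub>M a\<in>I. borel) (\<lambda>\<omega>. \<lambda>a\<in>I. \<eta> (t (fst a)) \<omega> $ snd a)"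
    proof (rule distr_PiM_eqI_of_cdf_eq[OF I N.finite_measure_axioms N.finite_measure_axioms])
      fix x :: "nat \<times> 'd \<Rightarrow> real"
      show "N.prob {\<omega> \<in> space N. \<forall>a\<in>I. \<eta> (t (fst a) + s) \<omega> $ snd a \<le> x a}
          = N.prob {\<omega> \<in> space N. \<forall>a\<in>I. \<eta> (t (fst a)) \<omega> $ snd a \<le> x a}"
      proof (cases "n = 0")
        case False
        then have "I \<noteq> {}" by (auto simp: I_def lessThan_empty_iff)
        moreover have "(LINT \<omega>|M. Max ((\<lambda>a. 1 / x a * exp (\<xi> (t (fst a) + s) \<omega> $ snd a)) ` I))
            = (LINT \<omega>|M. Max ((\<lambda>a. 1 / x a * exp (\<xi> (t (fst a)) \<omega> $ snd a)) ` I))" if "\<forall>a\<in>I. 0 < x a"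
          using mm[unfolded max_moments_stationary_def, rule_format, of n "\<lambda>a. 1 / x a" t s] that False
          by (simp add: I_def)
        ultimately show ?thesis
          using prob_process_le[OF I, of "\<lambda>a. t (fst a) + s" snd x] prob_process_le[OF I, of "\<lambda>a. t (fst a)" snd x]
          by simp
      qed (simp add: I_def)
    qed measurable
    then show "distr N (\<Pi>\<^sub>M i\<in>{..<n}. borel) (\<lambda>\<omega>. \<lambda>i\<in>{..<n}. \<eta> (t i + s) \<omega>)
        = distr N (\<Pi>\<^sub>M i\<in>{..<n}. borel) (\<lambda>\<omega>. \<lambda>i\<in>{..<n}. \<eta> (t i) \<omega>)"
      using push[of "\<lambda>i. t i + s"] push[of t] by simp
  qed (rule \<eta>_measurable)
qed

end

section \<open>The characteristic functions of the shifted arguments\<close>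

text \<open>
  With these weights, \<open>exp (\<Sum> p\<^sub>a X\<^sub>a)\<close> is the geometric mean of the exponentials of the coordinates at the
  first time, which has index \<open>0\<close>.
\<close>

definition geometric_mean_weights :: "nat \<times> 'd \<Rightarrow> real" where
  "geometric_mean_weights a = (if fst a = 0 then 1 / CARD('d) else 0)"

lemma geometric_mean_weights_nonneg: "0 \<le> geometric_mean_weights a"
  by (simp add: geometric_mean_weights_def)

lemma sum_geometric_mean_weights:
  assumes "n \<ge> 1"
  shows "(\<Sum>a\<in>{..<n} \<times> (UNIV :: 'd::finite set). geometric_mean_weights a) = 1"
proof -
  have "(\<Sum>a\<in>{..<n} \<times> (UNIV :: 'd set). geometric_mean_weights a)
      = (\<Sum>i<n. \<Sum>k\<in>(UNIV :: 'd set). if i = 0 then 1 / CARD('d) else 0)"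
    unfolding sum.cartesian_product geometric_mean_weights_def case_prod_beta ..
  also have "\<dots> = (\<Sum>i<n. if i = 0 then 1 else 0)"
    by (rule sum.cong) auto
  also have "\<dots> = 1" using assms by (simp add: sum.delta)
  finally show ?thesis .
qed

text \<open>
  The imaginary shift of the first argument contributes \<open>\<i> * (- \<i> / d) = 1 / d\<close> times the sum of the
  coordinates at the first time, the real exponent.
\<close>

lemma joint_char_shifted_args:
  fixes \<xi> :: "real \<Rightarrow> 'a \<Rightarrow> real ^ 'd" and n :: nat
  defines "I \<equiv> {..<n} \<times> (UNIV :: 'd set)"
  shows "joint_char M \<xi> n t (shifted_args u) =
    (LINT \<omega>|M. exp (\<Sum>a\<in>I. geometric_mean_weights a * \<xi> (t (fst a)) \<omega> $ snd a)
       *\<^sub>R iexp (\<Sum>a\<in>I. u (fst a) $ snd a * \<xi> (t (fst a)) \<omega> $ snd a))"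
  unfolding joint_char_def
proof (rule Bochner_Integration.integral_cong[OF refl])
  fix \<omega>
  have "\<i> * (\<Sum>i<n. bilinear_pairing (shifted_args u i) (\<xi> (t i) \<omega>))
      = (\<Sum>a\<in>I. \<i> * (shifted_args u (fst a) $ snd a * complex_of_real (\<xi> (t (fst a)) \<omega> $ snd a)))"
    by (simp add: I_def bilinear_pairing_def sum.cartesian_product case_prod_beta sum_distrib_left)
  also have "\<dots> = (\<Sum>a\<in>I. complex_of_real (geometric_mean_weights a * \<xi> (t (fst a)) \<omega> $ snd a)
      + \<i> * complex_of_real (u (fst a) $ snd a * \<xi> (t (fst a)) \<omega> $ snd a))"
    by (rule sum.cong) (auto simp: shifted_args_def geometric_mean_weights_def algebra_simps)
  also have "\<dots> = complex_of_real (\<Sum>a\<in>I. geometric_mean_weights a * \<xi> (t (fst a)) \<omega> $ snd a)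
      + \<i> * complex_of_real (\<Sum>a\<in>I. u (fst a) $ snd a * \<xi> (t (fst a)) \<omega> $ snd a)"
    by (simp add: sum.distrib sum_distrib_left)
  finally show "exp (\<i> * (\<Sum>i<n. bilinear_pairing (shifted_args u i) (\<xi> (t i) \<omega>)))
      = exp (\<Sum>a\<in>I. geometric_mean_weights a * \<xi> (t (fst a)) \<omega> $ snd a)
       *\<^sub>R iexp (\<Sum>a\<in>I. u (fst a) $ snd a * \<xi> (t (fst a)) \<omega> $ snd a)"
    by (simp only: exp_add exp_of_real scaleR_conv_of_real)
qed

theorem theorem5p2:
  fixes M :: "'a measure" and \<xi> :: "real \<Rightarrow> 'a \<Rightarrow> real ^ 'd"
    and N :: "'w measure" and y :: "nat \<Rightarrow> 'w \<Rightarrow> real"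
    and \<Xi> :: "nat \<Rightarrow> real \<Rightarrow> 'w \<Rightarrow> real ^ 'd"
  assumes "prob_space M"
    and "\<And>t. \<xi> t \<in> borel_measurable M"
    and "\<And>t k. integrable M (\<lambda>\<omega>. exp (\<xi> t \<omega> $ k))"
    and "brown_resnick_data M \<xi> N y \<Xi>"
  shows "strictly_stationary N (brown_resnick_process y \<Xi>) \<longleftrightarrow>
    (\<forall>(n::nat) (s::real) (t :: nat \<Rightarrow> real) (u :: nat \<Rightarrow> real ^ 'd).
       n \<ge> 1 \<and> (\<Sum>i<n. \<Sum>j\<in>UNIV. u i $ j) = 0 \<longrightarrow>
       joint_char M \<xi> n t (shifted_args u) = joint_char M \<xi> n (\<lambda>i. t i + s) (shifted_args u))"
proof -
  interpret brown_resnick_representation M \<xi> N y \<Xi>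
    by (rule brown_resnick_representation.intro) (fact assms)+
  have meas [measurable]: "(\<lambda>\<omega>. \<xi> (r (fst a)) \<omega> $ snd a) \<in> borel_measurable M" for r :: "nat \<Rightarrow> real" and a :: "nat \<times> 'd"
    by measurable
  show ?thesis
    unfolding strictly_stationary_iff_max_moments max_moments_stationary_def
  proof (intro iffI allI impI)
    fix n :: nat and s :: real and t :: "nat \<Rightarrow> real" and u :: "nat \<Rightarrow> real ^ 'd"
    assume mm: "\<forall>(n::nat) (t :: nat \<Rightarrow> real) (s::real) (c :: nat \<times> 'd \<Rightarrow> real).
       n \<ge> 1 \<longrightarrow> (\<forall>a\<in>{..<n} \<times> UNIV. 0 < c a) \<longrightarrow>
       (LINT \<omega>|M. Max ((\<lambda>a. c a * exp (\<xi> (t (fst a) + s) \<omega> $ snd a)) ` ({..<n} \<times> UNIV)))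
       = (LINT \<omega>|M. Max ((\<lambda>a. c a * exp (\<xi> (t (fst a)) \<omega> $ snd a)) ` ({..<n} \<times> UNIV)))"
    assume "n \<ge> 1 \<and> (\<Sum>i<n. \<Sum>j\<in>UNIV. u i $ j) = 0"
    then have n: "n \<ge> 1" and u: "(\<Sum>a\<in>{..<n} \<times> UNIV. u (fst a) $ snd a) = 0"
      by (simp_all add: sum.cartesian_product case_prod_beta)
    show "joint_char M \<xi> n t (shifted_args u) = joint_char M \<xi> n (\<lambda>i. t i + s) (shifted_args u)"
      unfolding joint_char_shifted_args
    proof (rule tilted_char_eq_of_expectation_Max_eq[where X="\<lambda>a \<omega>. \<xi> (t (fst a)) \<omega> $ snd a" 
          and Y="\<lambda>a \<omega>. \<xi> (t (fst a) + s) \<omega> $ snd a" and u="\<lambda>a. u (fst a) $ snd a"])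
      fix c :: "nat \<times> 'd \<Rightarrow> real"
      assume "\<And>a. a \<in> {..<n} \<times> UNIV \<Longrightarrow> 0 < c a"
      then show "(LINT \<omega>|M. Max ((\<lambda>a. c a * exp (\<xi> (t (fst a)) \<omega> $ snd a)) ` ({..<n} \<times> UNIV)))
        = (LINT \<omega>|M. Max ((\<lambda>a. c a * exp (\<xi> (t (fst a) + s) \<omega> $ snd a)) ` ({..<n} \<times> UNIV)))"
        using mm n by auto
    qed (use n u meas[of "\<lambda>i. t i + s"] in \<open>simp_all add: integrable_exp sum_geometric_mean_weights\<close>)
  next
    fix n :: nat and t :: "nat \<Rightarrow> real" and s :: real and c :: "nat \<times> 'd \<Rightarrow> real"
    assume jc: "\<forall>(n::nat) (s::real) (t :: nat \<Rightarrow> real) (u :: nat \<Rightarrow> real ^ 'd).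
       n \<ge> 1 \<and> (\<Sum>i<n. \<Sum>j\<in>UNIV. u i $ j) = 0 \<longrightarrow>
       joint_char M \<xi> n t (shifted_args u) = joint_char M \<xi> n (\<lambda>i. t i + s) (shifted_args u)"
    assume n: "n \<ge> 1" and c: "\<forall>a\<in>{..<n} \<times> UNIV. 0 < c a"
    show "(LINT \<omega>|M. Max ((\<lambda>a. c a * exp (\<xi> (t (fst a) + s) \<omega> $ snd a)) ` ({..<n} \<times> UNIV)))
     = (LINT \<omega>|M. Max ((\<lambda>a. c a * exp (\<xi> (t (fst a)) \<omega> $ snd a)) ` ({..<n} \<times> UNIV)))"
    proof (rule expectation_Max_eq_of_tilted_char_eq[where X="\<lambda>a \<omega>. \<xi> (t (fst a) + s) \<omega> $ snd a" 
          and Y="\<lambda>a \<omega>. \<xi> (t (fst a)) \<omega> $ snd a" and p=geometric_mean_weights])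
      show "0 < c a" if "a \<in> {..<n} \<times> UNIV" for a
        using c that by blast
      fix u :: "nat \<times> 'd \<Rightarrow> real"
      assume "(\<Sum>a\<in>{..<n} \<times> UNIV. u a) = 0"
      then have "(\<Sum>i<n. \<Sum>j\<in>UNIV. (\<chi> k. u (i, k)) $ j) = 0"
        by (simp add: sum.cartesian_product)
      with n have "joint_char M \<xi> n t (shifted_args (\<lambda>i. \<chi> k. u (i, k)))
          = joint_char M \<xi> n (\<lambda>i. t i + s) (shifted_args (\<lambda>i. \<chi> k. u (i, k)))"
        by (intro jc[rule_format] conjI)
      then show "(LINT \<omega>|M. exp (\<Sum>a\<in>{..<n} \<times> UNIV. geometric_mean_weights a * \<xi> (t (fst a) + s) \<omega> $ snd a)
            *\<^sub>R iexp (\<Sum>a\<in>{..<n} \<times> UNIV. u a * \<xi> (t (fst a) + s) \<omega> $ snd a))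
          = (LINT \<omega>|M. exp (\<Sum>a\<in>{..<n} \<times> UNIV. geometric_mean_weights a * \<xi> (t (fst a)) \<omega> $ snd a)
            *\<^sub>R iexp (\<Sum>a\<in>{..<n} \<times> UNIV. u a * \<xi> (t (fst a)) \<omega> $ snd a))"
        unfolding joint_char_shifted_args by (simp del: of_real_sum of_real_mult)
    qed (use n meas[of "\<lambda>i. t i + s"] in
        \<open>simp_all add: integrable_exp sum_geometric_mean_weights geometric_mean_weights_nonneg\<close>)
  qed
qed

end
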